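(* Let $n\ge1$, let $(\phi,\mathbf u,p,U,W)^{n-1}$ and $(\phi,\mathbf u,p,U,W)^n$ be given, and let $\phi^{n+1},\mu^{n+1},\widetilde{\mathbf u}^{n+1},U^{n+1},W^{n+1},\mathbf u^{n+1},p^{n+1}$ be produced by the following (BDF2) scheme with time step $\delta t>0$. Step 1: in $\Omega$, $$\frac{3\phi^{n+1}-4\phi^n+\phi^{n-1}}{2\delta t}+\nabla\cdot(\widetilde{\mathbf u}^{n+1}\phi_\star^{n+1})=M\Delta\mu^{n+1},$$ $$\mu^{n+1}=\lambda\Big(-\varepsilon\Delta\phi^{n+1}+\frac1\varepsilon\phi_\star^{n+1}U^{n+1}\Big),$$ $$3U^{n+1}-4U^n+U^{n-1}=2\phi_\star^{n+1}(3\phi^{n+1}-4\phi^n+\phi^{n-1}),$$ $$\frac{3\widetilde{\mathbf u}^{n+1}-4\mathbf u^n+\mathbf u^{n-1}}{2\delta t}+B(\mathbf u_\star^{n+1},\widetilde{\mathbf u}^{n+1})-\nu\Delta\widetilde{\mathbf u}^{n+1}+\nabla p^n+\phi_\star^{n+1}\nabla\mu^{n+1}=0,$$ with, on $\Gamma$, $$\widetilde{\mathbf u}^{n+1}\cdot\mathbf n=0,\qquad \nu\partial_{\mathbf n}\widetilde{\mathbf u}_\tau^{n+1}=-\nu\ell(\phi_\star^{n+1})(\widetilde{\mathbf u}^{n+1}-\mathbf u_w)-\frac\lambda\gamma\dot\phi^{n+1}\nabla_\tau\phi_\star^{n+1},$$ $$\partial_{\mathbf n}\mu^{n+1}=0,\qquad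 \varepsilon\partial_{\mathbf n}\phi^{n+1}=-\frac1\gamma\dot\phi^{n+1}-Z(\phi_\star^{n+1})W^{n+1},$$ $$3W^{n+1}-4W^n+W^{n-1}=\frac12Z(\phi_\star^{n+1})(3\phi^{n+1}-4\phi^n+\phi^{n-1}),$$ where $\dot\phi^{n+1}=\frac{3\phi^{n+1}-4\phi^n+\phi^{n-1}}{2\delta t}+\widetilde{\mathbf u}_\tau^{n+1}\cdot\nabla_\tau\phi_\star^{n+1}$. Step 2: $$\frac{3}{2\delta t}\big(\mathbf u^{n+1}-\widetilde{\mathbf u}^{n+1}\big)+\nabla(p^{n+1}-p^n)=0,\quad\nabla\cdot\mathbf u^{n+1}=0\ \text{ in }\Omega,\qquad\mathbf u^{n+1}\cdot\mathbf n=0\ \text{ on }\Gamma.$$ Then the scheme is unconditionally energy stable, satisfying (for every $\delta t>0$) the following discrete energy dissipation law: $$E_{bdf}^{n+1}\le E_{bdf}^n-M\delta t\|\nabla\mu^{n+1}\|^2-\nu\delta t\|\nabla\widetilde{\mathbf u}^{n+1}\|^2-\frac\lambda\gamma\delta t\|\dot\phi^{n+1}\|_\Gamma^2-\nu\delta t\big\|\ell(\phi_\star^{n+1})^{\frac12}\widetilde{\mathbf u}_s^{n+1}\big\|_\Gamma^2-\nu\delta t\big(\ell(\phi_\star^{n+1})\widetilde{\mathbf u}_s^{n+1},\mathbf u_w\big)_\Gamma,$$ where $\widetilde{\mathbf u}_s^{n+1}=\widetilde{\mathbf u}^{n+1}-\mathbf u_w$ and $$E_{bdf}^n=\frac12E(\mathbf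 u^n,\phi^n,U^n,W^n)+\frac12E(\mathbf u_\star^{n+1},\phi_\star^{n+1},U_\star^{n+1},W_\star^{n+1})+\frac{\delta t^2}{3}\|\nabla p^n\|^2 .$$
   Context: $\Omega\subset\mathbb R^d$ ($d=2,3$) is a bounded domain with boundary $\Gamma$ and outward unit normal $\mathbf n$. $M,\lambda,\varepsilon,\nu,\gamma>0$ are constants, $\ell(\cdot)\ge0$ is a given coefficient function, $\mathbf u_w$ is the given wall velocity on $\Gamma$ (independent of $n$), $\theta_s$ is a given angle. $\phi,\mu,p,U$ are scalar functions on $\Omega$, $\mathbf u,\widetilde{\mathbf u}$ vector fields on $\Omega$, $W$ a scalar function on $\Gamma$. Notation: for a sequence $S^n$, $S_\star^{n+1}=2S^n-S^{n-1}$ (hence $S_\star^{n+2}=2S^{n+1}-S^n$, which enters $E_{bdf}^{n+1}$). $(\cdot,\cdot),\|\cdot\|$ and $(\cdot,\cdot)_\Gamma,\|\cdot\|_\Gamma$ are the $L^2(\Omega)$ and $L^2(\Gamma)$ inner products and norms. $B(\mathbf a,\mathbf b)=(\mathbf a\cdot\nabla)\mathbf b+\frac12(\nabla\cdot\mathbf a)\mathbf b$. $\nabla_\tau=\nabla-(\mathbf n\cdot\nabla)\mathbf n$ is the tangential gradient on $\Gamma$; a subscript $\tau$ on a vector denotes its tangential part on $\Gamma$, and $\partial_{\mathbf n}\mathbf v_\tau$ denotes the tangential part of $\partial_{\mathbf n}\mathbf v$. $G(\phi)=-\frac{\sqrt2}{3}\cos\theta_s\sin(\frac\pi2\phi)$,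 $g=G'$, $C$ is a constant such that $G+C$ is positive (e.g. $C=\frac{\sqrt2}3+\eta$, $\eta>0$), $Z(\phi)=g(\phi)/\sqrt{G(\phi)+C}$. The energy functional is $$E(\mathbf u,\phi,U,W)=\int_\Omega\Big(\frac12|\mathbf u|^2+\lambda\Big(\frac\varepsilon2|\nabla\phi|^2+\frac1{4\varepsilon}U^2\Big)\Big)d\mathbf x+\lambda\int_\Gamma W^2ds-\lambda C|\Gamma|.$$ Standing assumptions: all functions are sufficiently smooth for the equations and the integrations by parts to make sense, and the previous velocities satisfy $\nabla\cdot\mathbf u^{k}=0$ in $\Omega$ and $\mathbf u^k\cdot\mathbf n=0$ on $\Gamma$ for $k=n-1,n$ (as they are outputs of Step 2 or admissible starting data). *)

theory Defs
  imports "HOL-Analysis.Analysis"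
begin

section \<open>Surface measure\<close>

text \<open>The \<open>m\<close>-dimensional Hausdorff measure (\<open>m > 0\<close>), normalised so that it agrees with
  Lebesgue measure on \<open>m\<close>-dimensional planes. Boundedness of the covering sets has to be required
  explicitly because \<^const>\<open>diameter\<close> of an unbounded set is unspecified. The outer measure is a
  metric outer measure, hence countably additive on the Borel sets.\<close>

definition hausdorff_pre :: "nat \<Rightarrow> real \<Rightarrow> 'a::metric_space set \<Rightarrow> ennreal" where
  "hausdorff_pre m r A =
     (INF C \<in> {C :: nat \<Rightarrow> 'a set. A \<subseteq> (\<Union>j. C j) \<and> (\<forall>j. bounded (C j) \<and> diameter (C j) \<le> r)}.
        \<Sum>j. ennreal (unit_ball_vol (real m) * (diameter (C j) / 2) ^ m))"

definition hausdorff_outer :: "nat \<Rightarrow> 'a::metric_space set \<Rightarrow> ennreal" where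
  "hausdorff_outer m A = (SUP r \<in> {0<..}. hausdorff_pre m r A)"

definition hausdorff_measure :: "nat \<Rightarrow> 'a::metric_space measure" where
  "hausdorff_measure m = measure_of UNIV (sets borel) (hausdorff_outer m)"

definition surface_measure :: "(real ^ 'd) set \<Rightarrow> (real ^ 'd) measure" where
  "surface_measure \<Omega> = restrict_space (hausdorff_measure (CARD('d) - 1)) (frontier \<Omega>)"


section \<open>Differential operators\<close>

definition pd :: "'d \<Rightarrow> (real ^ 'd \<Rightarrow> 'b::real_normed_vector) \<Rightarrow> real ^ 'd \<Rightarrow> 'b" where
  "pd i f x = frechet_derivative f (at x) (axis i 1)"

definition grad :: "(real ^ 'd \<Rightarrow> real) \<Rightarrow> real ^ 'd \<Rightarrow> real ^ 'd" where
  "grad f x = (\<chi> i. pd i f x)"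

text \<open>The inner product of \<^typ>\<open>real ^ 'd ^ 'd\<close> is the Frobenius inner product.\<close>

definition vgrad :: "(real ^ 'd \<Rightarrow> real ^ 'd) \<Rightarrow> real ^ 'd \<Rightarrow> real ^ 'd ^ 'd" where
  "vgrad v x = (\<chi> i j. pd j v x $ i)"

definition divg :: "(real ^ 'd \<Rightarrow> real ^ 'd) \<Rightarrow> real ^ 'd \<Rightarrow> real" where
  "divg v x = (\<Sum>i\<in>UNIV. pd i v x $ i)"

definition lap :: "(real ^ 'd \<Rightarrow> 'b::real_normed_vector) \<Rightarrow> real ^ 'd \<Rightarrow> 'b" where
  "lap f x = (\<Sum>i\<in>UNIV. pd i (pd i f) x)"

definition convect :: "(real ^ 'd \<Rightarrow> real ^ 'd) \<Rightarrow> (real ^ 'd \<Rightarrow> real ^ 'd) \<Rightarrow> real ^ 'd \<Rightarrow> real ^ 'd" where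
  "convect a b x = (\<Sum>i\<in>UNIV. a x $ i *\<^sub>R pd i b x) + (1/2) *\<^sub>R (divg a x *\<^sub>R b x)"

definition normal_deriv ::
  "(real ^ 'd \<Rightarrow> real ^ 'd) \<Rightarrow> (real ^ 'd \<Rightarrow> 'b::real_normed_vector) \<Rightarrow> real ^ 'd \<Rightarrow> 'b" where
  "normal_deriv nrm f x = frechet_derivative f (at x) (nrm x)"

definition tang :: "(real ^ 'd \<Rightarrow> real ^ 'd) \<Rightarrow> (real ^ 'd \<Rightarrow> real ^ 'd) \<Rightarrow> real ^ 'd \<Rightarrow> real ^ 'd" where
  "tang nrm v x = v x - (v x \<bullet> nrm x) *\<^sub>R nrm x"

definition tgrad :: "(real ^ 'd \<Rightarrow> real ^ 'd) \<Rightarrow> (real ^ 'd \<Rightarrow> real) \<Rightarrow> real ^ 'd \<Rightarrow> real ^ 'd" where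
  "tgrad nrm f x = grad f x - normal_deriv nrm f x *\<^sub>R nrm x"


section \<open>Smoothness up to the boundary\<close>

primrec Ck_on :: "nat \<Rightarrow> (real ^ 'd) set \<Rightarrow> (real ^ 'd \<Rightarrow> 'b::real_normed_vector) \<Rightarrow> bool" where
  "Ck_on 0 S f \<longleftrightarrow> continuous_on S f"
| "Ck_on (Suc k) S f \<longleftrightarrow> f differentiable_on S \<and> (\<forall>i. Ck_on k S (pd i f))"

text \<open>Functions on the closure of a domain are represented by functions on the whole space that are
  smooth on a neighbourhood of the closure; their values away from the closure are irrelevant.\<close>

definition Ck_upto :: "nat \<Rightarrow> (real ^ 'd) set \<Rightarrow> (real ^ 'd \<Rightarrow> 'b::real_normed_vector) \<Rightarrow> bool" where
  "Ck_upto k \<Omega> f \<longleftrightarrow> (\<exists>S. open S \<and> closure \<Omega> \<subseteq> S \<and> Ck_on k S f)"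


section \<open>Domains\<close>

text \<open>\<open>n\<close> is the outward unit normal of \<open>\<Omega>\<close> at \<open>x\<close>: every direction strictly pointing against
  \<open>n\<close> enters \<open>\<Omega>\<close>, every direction strictly pointing along \<open>n\<close> leaves its closure.\<close>

definition outward_unit_normal :: "(real ^ 'd) set \<Rightarrow> real ^ 'd \<Rightarrow> real ^ 'd \<Rightarrow> bool" where
  "outward_unit_normal \<Omega> x n \<longleftrightarrow> norm n = 1 \<and>
     (\<forall>v. v \<bullet> n < 0 \<longrightarrow> (\<forall>\<^sub>F t in at_right 0. x + t *\<^sub>R v \<in> \<Omega>)) \<and>
     (\<forall>v. v \<bullet> n > 0 \<longrightarrow> (\<forall>\<^sub>F t in at_right 0. x + t *\<^sub>R v \<notin> closure \<Omega>))"

text \<open>A bounded domain with outward unit normal field \<open>nrm\<close> whose boundary is regular enough for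
  integration by parts, that is, for the divergence theorem to hold for the surface measure and
  \<open>nrm\<close>. All bounded Lipschitz domains are of this kind; since these may have corners, the normal is
  only required to exist almost everywhere.\<close>

definition domain_with_normal :: "(real ^ 'd) set \<Rightarrow> (real ^ 'd \<Rightarrow> real ^ 'd) \<Rightarrow> bool" where
  "domain_with_normal \<Omega> nrm \<longleftrightarrow>
     open \<Omega> \<and> connected \<Omega> \<and> bounded \<Omega> \<and> \<Omega> \<noteq> {} \<and>
     finite_measure (surface_measure \<Omega>) \<and>
     nrm \<in> borel_measurable (surface_measure \<Omega>) \<and>
     (AE x in surface_measure \<Omega>. outward_unit_normal \<Omega> x (nrm x)) \<and>
     (\<forall>F :: real ^ 'd \<Rightarrow> real ^ 'd. Ck_upto 1 \<Omega> F \<longrightarrow>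
        (LINT x|lebesgue_on \<Omega>. divg F x) = (LINT x|surface_measure \<Omega>. F x \<bullet> nrm x))"


section \<open>Inner products, energy and scheme notation\<close>

definition L2_inner :: "'a measure \<Rightarrow> ('a \<Rightarrow> 'b::real_inner) \<Rightarrow> ('a \<Rightarrow> 'b) \<Rightarrow> real" where
  "L2_inner \<mu> f g = (LINT x|\<mu>. f x \<bullet> g x)"

definition L2_norm :: "'a measure \<Rightarrow> ('a \<Rightarrow> 'b::real_inner) \<Rightarrow> real" where
  "L2_norm \<mu> f = sqrt (L2_inner \<mu> f f)"

definition energy ::
  "(real ^ 'd) set \<Rightarrow> real \<Rightarrow> real \<Rightarrow> real \<Rightarrow>
   (real ^ 'd \<Rightarrow> real ^ 'd) \<Rightarrow> (real ^ 'd \<Rightarrow> real) \<Rightarrow> (real ^ 'd \<Rightarrow> real) \<Rightarrow> (real ^ 'd \<Rightarrow> real) \<Rightarrow> real" where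
  "energy \<Omega> lam \<epsilon> C u \<phi> U W =
     (LINT x|lebesgue_on \<Omega>.
        (1/2) * (norm (u x))\<^sup>2 + lam * (\<epsilon>/2 * (norm (grad \<phi> x))\<^sup>2 + 1/(4*\<epsilon>) * (U x)\<^sup>2))
     + lam * (LINT x|surface_measure \<Omega>. (W x)\<^sup>2)
     - lam * C * measure (surface_measure \<Omega>) (frontier \<Omega>)"

text \<open>The extrapolation at time level \<open>k \<ge> 2\<close>.\<close>

definition star :: "(nat \<Rightarrow> 'a \<Rightarrow> 'b::real_vector) \<Rightarrow> nat \<Rightarrow> 'a \<Rightarrow> 'b" where
  "star S k x = 2 *\<^sub>R S (k - 1) x - S (k - 2) x"

text \<open>The numerator of the second order backward difference at time level \<open>k \<ge> 2\<close>.\<close>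

definition bdf :: "(nat \<Rightarrow> 'a \<Rightarrow> 'b::real_vector) \<Rightarrow> nat \<Rightarrow> 'a \<Rightarrow> 'b" where
  "bdf S k x = 3 *\<^sub>R S k x - 4 *\<^sub>R S (k - 1) x + S (k - 2) x"

definition energy_bdf ::
  "(real ^ 'd) set \<Rightarrow> real \<Rightarrow> real \<Rightarrow> real \<Rightarrow> real \<Rightarrow>
   (nat \<Rightarrow> real ^ 'd \<Rightarrow> real ^ 'd) \<Rightarrow> (nat \<Rightarrow> real ^ 'd \<Rightarrow> real) \<Rightarrow> (nat \<Rightarrow> real ^ 'd \<Rightarrow> real) \<Rightarrow>
   (nat \<Rightarrow> real ^ 'd \<Rightarrow> real) \<Rightarrow> (nat \<Rightarrow> real ^ 'd \<Rightarrow> real) \<Rightarrow> nat \<Rightarrow> real" where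
  "energy_bdf \<Omega> lam \<epsilon> C dt u \<phi> U W p k =
     (1/2) * energy \<Omega> lam \<epsilon> C (u k) (\<phi> k) (U k) (W k)
     + (1/2) * energy \<Omega> lam \<epsilon> C (star u (k+1)) (star \<phi> (k+1)) (star U (k+1)) (star W (k+1))
     + dt\<^sup>2 / 3 * (L2_norm (lebesgue_on \<Omega>) (grad (p k)))\<^sup>2"

definition phi_dot ::
  "(real ^ 'd \<Rightarrow> real ^ 'd) \<Rightarrow> real \<Rightarrow> (nat \<Rightarrow> real ^ 'd \<Rightarrow> real) \<Rightarrow> (real ^ 'd \<Rightarrow> real ^ 'd) \<Rightarrow>
   nat \<Rightarrow> real ^ 'd \<Rightarrow> real" where
  "phi_dot nrm dt \<phi> ut k x =
     bdf \<phi> k x / (2*dt) + tang nrm ut x \<bullet> tgrad nrm (star \<phi> k) x"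

definition wall_G :: "real \<Rightarrow> real \<Rightarrow> real" where
  "wall_G \<theta> s = - (sqrt 2 / 3) * cos \<theta> * sin (pi/2 * s)"

definition wall_Z :: "real \<Rightarrow> real \<Rightarrow> real \<Rightarrow> real" where
  "wall_Z \<theta> C s = deriv (wall_G \<theta>) s / sqrt (wall_G \<theta> s + C)"

end

theory Submission
  imports Defs
begin

text \<open>All integrations by parts are carried out at once, by applying the divergence theorem to a
  single flux \<open>F\<close> that collects the boundary fluxes of the tested equations. In \<open>\<Omega>\<close> the equations of
  both steps give pointwise that the increment of the energy density plus the bulk dissipation is at
  most the divergence of \<open>F\<close>; on the boundary the wall conditions give almost everywhere that the
  increment of the wall energy density plus the wall dissipation is at most \<open>- F \<bullet> nrm\<close>. Both rest on
  \<open>2 (3a - 4b + c) \<bullet> a = |a|\<^sup>2 + |2a - b|\<^sup>2 - |b|\<^sup>2 - |2b - c|\<^sup>2 + |a - 2b + c|\<^sup>2\<close>. The pressure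
  part of the energy comes from the projection step: it gives
  \<open>ut = u (n+1) + (2 dt / 3) (\<nabla>p (n+1) - \<nabla>p n)\<close>, and the products of velocities with pressure
  gradients are divergences because the velocities are solenoidal.\<close>

section \<open>Calculus of functions that are smooth up to the boundary\<close>

lemma pd_eq:
  assumes "(f has_derivative f') (at x)"
  shows "pd i f x = f' (axis i 1)"
  using frechet_derivative_at[OF assms] by (simp add: pd_def)

lemma differentiable_imp_has_derivative:
  assumes "f differentiable at x"
  shows "(f has_derivative frechet_derivative f (at x)) (at x)"
  using assms by (simp add: frechet_derivative_works)

lemma pd_bilinear:
  assumes "bounded_bilinear pr" "f differentiable at x" "g differentiable at x"
  shows "pd i (\<lambda>y. pr (f y) (g y)) x = pr (f x) (pd i g x) + pr (pd i f x) (g x)"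
  using pd_eq[OF bounded_bilinear.FDERIV[OF assms(1) differentiable_imp_has_derivative[OF assms(2)]
        differentiable_imp_has_derivative[OF assms(3)]]]
  by (simp add: pd_def)

lemma pd_linear:
  assumes "bounded_linear h" "f differentiable at x"
  shows "pd i (\<lambda>y. h (f y)) x = h (pd i f x)"
  using pd_eq[OF bounded_linear.has_derivative[OF assms(1) differentiable_imp_has_derivative[OF assms(2)]]]
  by (simp add: pd_def)

lemma pd_add:
  assumes "f differentiable at x" "g differentiable at x"
  shows "pd i (\<lambda>y. f y + g y) x = pd i f x + pd i g x"
  using pd_eq[OF has_derivative_add[OF differentiable_imp_has_derivative[OF assms(1)]
        differentiable_imp_has_derivative[OF assms(2)]]]
  by (simp add: pd_def)

lemma pd_sum:
  assumes "\<And>k. k \<in> I \<Longrightarrow> f k differentiable at x"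
  shows "pd i (\<lambda>y. \<Sum>k\<in>I. f k y) x = (\<Sum>k\<in>I. pd i (f k) x)"
  using pd_eq[OF has_derivative_sum[where I=I and f=f and f'="\<lambda>k. frechet_derivative (f k) (at x)"]]
    differentiable_imp_has_derivative[OF assms]
  by (simp add: pd_def)

lemma pd_scaleR_const:
  assumes "f differentiable at x"
  shows "pd i (\<lambda>y. c *\<^sub>R f y) x = c *\<^sub>R pd i f x"
  by (rule pd_linear[OF bounded_linear_scaleR_right assms])

lemma pd_diff:
  assumes "f differentiable at x" "g differentiable at x"
  shows "pd i (\<lambda>y. f y - g y) x = pd i f x - pd i g x"
  using pd_eq[OF has_derivative_diff[OF differentiable_imp_has_derivative[OF assms(1)]
        differentiable_imp_has_derivative[OF assms(2)]]]
  by (simp add: pd_def)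

lemma differentiable_bilinear:
  assumes "bounded_bilinear pr" "f differentiable at x" "g differentiable at x"
  shows "(\<lambda>y. pr (f y) (g y)) differentiable at x"
  using bounded_bilinear.FDERIV[OF assms(1) differentiable_imp_has_derivative[OF assms(2)]
        differentiable_imp_has_derivative[OF assms(3)]]
  by (auto simp: differentiable_def)

lemma differentiable_linear:
  assumes "bounded_linear h" "f differentiable at x"
  shows "(\<lambda>y. h (f y)) differentiable at x"
  using bounded_linear.has_derivative[OF assms(1) differentiable_imp_has_derivative[OF assms(2)]]
  by (auto simp: differentiable_def)

text \<open>Expanding in the standard basis reduces fields assembled from components to the sum and
  linearity rules.\<close>

lemma vec_lambda_eq_sum_axis: "(\<chi> j. a j) = (\<Sum>j\<in>UNIV. a j *\<^sub>R axis j (1::real))"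
  by (simp add: vec_eq_iff axis_def if_distrib cong: if_cong)

lemma pd_vec_lambda:
  fixes f :: "'n::finite \<Rightarrow> real ^ 'd \<Rightarrow> real"
  assumes "\<And>j. f j differentiable at x"
  shows "pd i (\<lambda>y. \<chi> j. f j y) x = (\<chi> j. pd i (f j) x)"
  unfolding vec_lambda_eq_sum_axis
  by (simp add: pd_sum assms differentiable_linear[OF bounded_linear_scaleR_left]
      pd_linear[OF bounded_linear_scaleR_left])

text \<open>On an open set, differentiability within the set is differentiability at each of its
  points, the form in which \<open>pd\<close> and the derivative rules are stated.\<close>

lemma Ck_upto_1_iff:
  "Ck_upto 1 \<Omega> f \<longleftrightarrow> (\<exists>S. open S \<and> closure \<Omega> \<subseteq> S \<and> (\<forall>x\<in>S. f differentiable at x)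
     \<and> (\<forall>i. continuous_on S (pd i f)))"
  unfolding Ck_upto_def One_nat_def Ck_on.simps
  by (metis at_within_open differentiable_on_def)

lemma Ck_upto_1D:
  assumes "Ck_upto 1 \<Omega> f"
  shows "\<exists>S. open S \<and> closure \<Omega> \<subseteq> S \<and> (\<forall>x\<in>S. f differentiable at x)
    \<and> (\<forall>i. continuous_on S (pd i f)) \<and> continuous_on S f"
  using assms unfolding Ck_upto_1_iff
  by (meson continuous_at_imp_continuous_on differentiable_imp_continuous_within)

text \<open>Continuity is proved for an explicit formula \<open>f'\<close> that agrees with the
  partial derivatives on \<open>S\<close>, so that \<open>pd\<close> itself never has to be
  handled.\<close>

lemma Ck_upto_1I:
  assumes "open S" "closure \<Omega> \<subseteq> S" "\<And>x. x \<in> S \<Longrightarrow> f differentiable at x"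
    "\<And>i x. x \<in> S \<Longrightarrow> pd i f x = f' i x" "\<And>i. continuous_on S (f' i)"
  shows "Ck_upto 1 \<Omega> f"
proof -
  have "continuous_on S (pd i f)" for i
    using assms(5)[of i] by (subst continuous_on_cong[OF refl assms(4)]) auto
  then show ?thesis unfolding Ck_upto_1_iff using assms by blast
qed

text \<open>The Leibniz rule holds on the intersection of the two neighbourhoods, which is again an
  open neighbourhood of the closure. Scalar multiples and inner products are the instances
  used.\<close>

lemma Ck_upto_1_bilinear:
  fixes f :: "real ^ 'd \<Rightarrow> 'b::real_normed_vector" and g :: "real ^ 'd \<Rightarrow> 'c::real_normed_vector"
  assumes "bounded_bilinear pr" "Ck_upto 1 \<Omega> f" "Ck_upto 1 \<Omega> g"
  shows "Ck_upto 1 \<Omega> (\<lambda>y. pr (f y) (g y))"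
proof -
  obtain S where S: "open S" "closure \<Omega> \<subseteq> S" "\<And>x. x \<in> S \<Longrightarrow> f differentiable at x"
    "\<And>i. continuous_on S (pd i f)" "continuous_on S f"
    using Ck_upto_1D[OF assms(2)] by blast
  obtain T where T: "open T" "closure \<Omega> \<subseteq> T" "\<And>x. x \<in> T \<Longrightarrow> g differentiable at x"
    "\<And>i. continuous_on T (pd i g)" "continuous_on T g"
    using Ck_upto_1D[OF assms(3)] by blast
  have sub: "continuous_on S h \<Longrightarrow> continuous_on (S \<inter> T) h"
    "continuous_on T k \<Longrightarrow> continuous_on (S \<inter> T) k"
    for h :: "real ^ 'd \<Rightarrow> 'b" and k :: "real ^ 'd \<Rightarrow> 'c"
    by (auto intro: continuous_on_subset)
  show ?thesis
  proof (rule Ck_upto_1I[of "S \<inter> T"])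
    show "pd i (\<lambda>y. pr (f y) (g y)) x = pr (f x) (pd i g x) + pr (pd i f x) (g x)"
      if "x \<in> S \<inter> T" for i x
      using that by (intro pd_bilinear assms S T) auto
    show "continuous_on (S \<inter> T) (\<lambda>x. pr (f x) (pd i g x) + pr (pd i f x) (g x))" for i
      by (intro continuous_intros bounded_bilinear.continuous_on[OF assms(1)] sub S T)
  qed (use S T in \<open>auto intro: differentiable_bilinear assms\<close>)
qed

lemmas Ck_upto_1_scaleR = Ck_upto_1_bilinear[OF bounded_bilinear_scaleR]
lemmas Ck_upto_1_inner = Ck_upto_1_bilinear[OF bounded_bilinear_inner]

lemma Ck_upto_1_linear:
  assumes "bounded_linear h" "Ck_upto 1 \<Omega> f"
  shows "Ck_upto 1 \<Omega> (\<lambda>y. h (f y))"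
proof -
  obtain S where S: "open S" "closure \<Omega> \<subseteq> S" "\<And>x. x \<in> S \<Longrightarrow> f differentiable at x"
    "\<And>i. continuous_on S (pd i f)" "continuous_on S f"
    using Ck_upto_1D[OF assms(2)] by blast
  show ?thesis
    by (rule Ck_upto_1I[of S, where f'="\<lambda>i x. h (pd i f x)"])
      (use S in \<open>auto intro: differentiable_linear pd_linear assms
        bounded_linear.continuous_on[OF assms(1)]\<close>)
qed

lemma Ck_upto_1_add:
  assumes "Ck_upto 1 \<Omega> f" "Ck_upto 1 \<Omega> g"
  shows "Ck_upto 1 \<Omega> (\<lambda>y. f y + g y)"
proof -
  obtain S where S: "open S" "closure \<Omega> \<subseteq> S" "\<And>x. x \<in> S \<Longrightarrow> f differentiable at x"
    "\<And>i. continuous_on S (pd i f)" "continuous_on S f"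
    using Ck_upto_1D[OF assms(1)] by blast
  obtain T where T: "open T" "closure \<Omega> \<subseteq> T" "\<And>x. x \<in> T \<Longrightarrow> g differentiable at x"
    "\<And>i. continuous_on T (pd i g)" "continuous_on T g"
    using Ck_upto_1D[OF assms(2)] by blast
  show ?thesis
  proof (rule Ck_upto_1I[of "S \<inter> T"])
    show "pd i (\<lambda>y. f y + g y) x = pd i f x + pd i g x" if "x \<in> S \<inter> T" for i x
      using that by (intro pd_add S T) auto
    show "continuous_on (S \<inter> T) (\<lambda>x. pd i f x + pd i g x)" for i
      by (intro continuous_intros continuous_on_subset[OF S(4)] continuous_on_subset[OF T(4)]) auto
  qed (use S T in \<open>auto intro: differentiable_add\<close>)
qed

lemma Ck_upto_1_scaleR_const: "Ck_upto 1 \<Omega> f \<Longrightarrow> Ck_upto 1 \<Omega> (\<lambda>y. c *\<^sub>R f y)"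
  by (rule Ck_upto_1_linear[OF bounded_linear_scaleR_right])

lemma Ck_upto_1_diff:
  assumes "Ck_upto 1 \<Omega> f" "Ck_upto 1 \<Omega> g"
  shows "Ck_upto 1 \<Omega> (\<lambda>y. f y - g y)"
  using Ck_upto_1_add[OF assms(1) Ck_upto_1_scaleR_const[OF assms(2), of "-1"]] by simp

lemma Ck_upto_1_zero: "Ck_upto 1 \<Omega> (\<lambda>y. 0)"
  by (rule Ck_upto_1I[of UNIV, where f'="\<lambda>i x. 0"]) (auto intro: pd_eq has_derivative_const)

lemma Ck_upto_1_sum:
  assumes "\<And>k. k \<in> I \<Longrightarrow> Ck_upto 1 \<Omega> (f k)"
  shows "Ck_upto 1 \<Omega> (\<lambda>y. \<Sum>k\<in>I. f k y)"
  using assms by (induction I rule: infinite_finite_induct) (simp_all add: Ck_upto_1_zero Ck_upto_1_add del: One_nat_def)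

lemma Ck_upto_1_vec_lambda:
  fixes f :: "'n::finite \<Rightarrow> real ^ 'd \<Rightarrow> real"
  assumes "\<And>j. Ck_upto 1 \<Omega> (f j)"
  shows "Ck_upto 1 \<Omega> (\<lambda>y. \<chi> j. f j y)"
  unfolding vec_lambda_eq_sum_axis
  by (intro Ck_upto_1_sum Ck_upto_1_linear[OF bounded_linear_scaleR_left] assms)

lemma Ck_upto_1_differentiable: "Ck_upto 1 \<Omega> f \<Longrightarrow> x \<in> closure \<Omega> \<Longrightarrow> f differentiable at x"
  by (blast dest: Ck_upto_1D)

lemma Ck_upto_1_continuous: "Ck_upto 1 \<Omega> f \<Longrightarrow> continuous_on (closure \<Omega>) f"
  by (blast dest: Ck_upto_1D intro: continuous_on_subset)

lemma Ck_upto_1_continuous_pd: "Ck_upto 1 \<Omega> f \<Longrightarrow> continuous_on (closure \<Omega>) (pd i f)"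
  by (blast dest: Ck_upto_1D intro: continuous_on_subset)

lemma Ck_upto_1_continuous_grad: "Ck_upto 1 \<Omega> f \<Longrightarrow> continuous_on (closure \<Omega>) (grad f)"
  unfolding grad_def by (intro continuous_on_vec_lambda Ck_upto_1_continuous_pd)

lemma Ck_upto_2_pd: "Ck_upto 2 \<Omega> f \<Longrightarrow> Ck_upto 1 \<Omega> (pd i f)"
  unfolding Ck_upto_def numeral_2_eq_2 One_nat_def Ck_on.simps by blast

text \<open>The definition at order two makes the first partial derivatives differentiable, hence
  continuous.\<close>

lemma Ck_upto_2_imp_1: "Ck_upto 2 \<Omega> f \<Longrightarrow> Ck_upto 1 \<Omega> f"
  unfolding Ck_upto_def numeral_2_eq_2 One_nat_def Ck_on.simps
  by (blast intro: differentiable_imp_continuous_on)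

lemma Ck_upto_2_grad: "Ck_upto 2 \<Omega> f \<Longrightarrow> Ck_upto 1 \<Omega> (grad f)"
  unfolding grad_def[abs_def] by (intro Ck_upto_1_vec_lambda Ck_upto_2_pd)


section \<open>Product rules for the vector operators\<close>

lemma grad_add:
  "f differentiable at x \<Longrightarrow> g differentiable at x \<Longrightarrow> grad (\<lambda>y. f y + g y) x = grad f x + grad g x"
  by (simp add: grad_def pd_add vec_eq_iff)

lemma grad_diff:
  "f differentiable at x \<Longrightarrow> g differentiable at x \<Longrightarrow> grad (\<lambda>y. f y - g y) x = grad f x - grad g x"
  by (simp add: grad_def pd_diff vec_eq_iff)

lemma grad_scaleR_const:
  "f differentiable at x \<Longrightarrow> grad (\<lambda>y. c *\<^sub>R f y) x = c *\<^sub>R grad f x"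
  using pd_scaleR_const[of f x] by (simp add: grad_def vec_eq_iff)

lemma divg_add:
  "f differentiable at x \<Longrightarrow> g differentiable at x \<Longrightarrow> divg (\<lambda>y. f y + g y) x = divg f x + divg g x"
  by (simp add: divg_def pd_add sum.distrib)

lemma divg_diff:
  "f differentiable at x \<Longrightarrow> g differentiable at x \<Longrightarrow> divg (\<lambda>y. f y - g y) x = divg f x - divg g x"
  by (simp add: divg_def pd_diff sum_subtractf)

lemma divg_scaleR_const:
  "f differentiable at x \<Longrightarrow> divg (\<lambda>y. c *\<^sub>R f y) x = c * divg f x"
  by (simp add: divg_def pd_scaleR_const sum_distrib_left)

lemma divg_scaleR:
  assumes "f differentiable at x" "v differentiable at x"
  shows "divg (\<lambda>y. f y *\<^sub>R v y) x = grad f x \<bullet> v x + f x * divg v x"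
  by (simp add: divg_def pd_bilinear[OF bounded_bilinear_scaleR assms] grad_def inner_vec_def
      sum.distrib sum_distrib_left)

lemma divg_grad:
  assumes "\<And>i. pd i f differentiable at x"
  shows "divg (grad f) x = lap f x"
  unfolding divg_def grad_def[abs_def] lap_def using assms by (simp add: pd_vec_lambda)

lemma grad_inner_self:
  assumes "v differentiable at x"
  shows "grad (\<lambda>y. v y \<bullet> v y) x = (\<chi> i. 2 * (pd i v x \<bullet> v x))"
  by (simp add: grad_def vec_eq_iff pd_bilinear[OF bounded_bilinear_inner assms assms] inner_commute)

text \<open>The half-divergence term of \<open>convect\<close> is exactly what completes the
  transport term, tested with \<open>b\<close>, to a full divergence. This is the pointwise form of
  skew-symmetry.\<close>

lemma convect_inner_self:
  assumes "a differentiable at x" "b differentiable at x"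
  shows "convect a b x \<bullet> b x = 1/2 * divg (\<lambda>y. (b y \<bullet> b y) *\<^sub>R a y) x"
proof -
  have "(\<lambda>y. b y \<bullet> b y) differentiable at x"
    by (rule differentiable_bilinear[OF bounded_bilinear_inner assms(2,2)])
  then have "divg (\<lambda>y. (b y \<bullet> b y) *\<^sub>R a y) x
      = (\<chi> i. 2 * (pd i b x \<bullet> b x)) \<bullet> a x + (b x \<bullet> b x) * divg a x"
    by (simp add: divg_scaleR assms(1) grad_inner_self[OF assms(2)])
  then show ?thesis
    by (simp add: convect_def inner_add_left inner_sum_left inner_vec_def[of "vec_lambda _"]
        sum_distrib_left sum_distrib_right mult_ac)
qed

text \<open>This is half the gradient of \<open>v \<bullet> v\<close>, written so that its normal
  component is the normal derivative of \<open>v\<close> tested with \<open>v\<close>. It is the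
  flux in Green's first identity for the vector Laplacian.\<close>

definition vgrad_flux :: "(real ^ 'd \<Rightarrow> real ^ 'd) \<Rightarrow> real ^ 'd \<Rightarrow> real ^ 'd" where
  "vgrad_flux v x = (\<chi> j. pd j v x \<bullet> v x)"

lemma vgrad_inner_self: "vgrad v x \<bullet> vgrad v x = (\<Sum>j\<in>UNIV. pd j v x \<bullet> pd j v x)"
  unfolding inner_vec_def vgrad_def by (simp, rule sum.swap)

text \<open>Green's first identity before integration: each component of the flux is differentiated
  by the product rule.\<close>

lemma divg_vgrad_flux:
  assumes "v differentiable at x" "\<And>i. pd i v differentiable at x"
  shows "divg (vgrad_flux v) x = lap v x \<bullet> v x + vgrad v x \<bullet> vgrad v x"
proof -
  have "(\<lambda>y. pd j v y \<bullet> v y) differentiable at x" for j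
    by (intro differentiable_bilinear[OF bounded_bilinear_inner] assms)
  then show ?thesis
    unfolding divg_def vgrad_flux_def[abs_def]
    by (simp add: pd_vec_lambda pd_bilinear[OF bounded_bilinear_inner assms(2,1)] sum.distrib
        lap_def inner_sum_left vgrad_inner_self)
qed

lemma Ck_upto_1_vgrad_flux: "Ck_upto 2 \<Omega> v \<Longrightarrow> Ck_upto 1 \<Omega> (vgrad_flux v)"
  unfolding vgrad_flux_def[abs_def]
  by (intro Ck_upto_1_vec_lambda Ck_upto_1_inner Ck_upto_2_pd Ck_upto_2_imp_1)

text \<open>The Frechet derivative is linear, so its value at the normal follows from its values at
  the basis vectors.\<close>

lemma normal_deriv_eq_sum:
  assumes "f differentiable at x"
  shows "normal_deriv nrm f x = (\<Sum>i\<in>UNIV. nrm x $ i *\<^sub>R pd i f x)"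
proof -
  interpret linear "frechet_derivative f (at x)"
    using assms by (rule linear_frechet_derivative)
  have "nrm x = (\<Sum>i\<in>UNIV. nrm x $ i *\<^sub>R axis i 1)"
    using vec_lambda_eq_sum_axis[of "\<lambda>i. nrm x $ i"] by simp
  then have "normal_deriv nrm f x = frechet_derivative f (at x) (\<Sum>i\<in>UNIV. nrm x $ i *\<^sub>R axis i 1)"
    unfolding normal_deriv_def by (rule arg_cong)
  then show ?thesis
    by (simp only: pd_def sum scaleR)
qed

lemma normal_deriv_eq_grad:
  assumes "f differentiable at x"
  shows "normal_deriv nrm f x = grad f x \<bullet> nrm x"
  by (simp add: normal_deriv_eq_sum[OF assms] grad_def inner_vec_def mult_ac)

lemma vgrad_flux_inner_normal:
  assumes "v differentiable at x"
  shows "vgrad_flux v x \<bullet> nrm x = normal_deriv nrm v x \<bullet> v x"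
  by (simp add: normal_deriv_eq_sum[OF assms] vgrad_flux_def inner_sum_left inner_vec_def[of "vec_lambda _"] mult_ac)

lemma continuous_on_vgrad_inner_self:
  assumes "Ck_upto 1 \<Omega> v"
  shows "continuous_on (closure \<Omega>) (\<lambda>x. vgrad v x \<bullet> vgrad v x)"
  unfolding vgrad_inner_self by (intro continuous_intros Ck_upto_1_continuous_pd assms)

text \<open>The triangle inequality with the Cauchy-Schwarz bound on the normal component gives the
  factor 2, which suffices for dominating the wall terms.\<close>

lemma norm_tang_le:
  assumes "norm (nrm x) = 1"
  shows "norm (tang nrm v x) \<le> 2 * norm (v x)"
proof -
  have "\<bar>v x \<bullet> nrm x\<bar> \<le> norm (v x)"
    using Cauchy_Schwarz_ineq2[of "v x" "nrm x"] assms by simp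
  then show ?thesis
    using norm_triangle_ineq4[of "v x" "(v x \<bullet> nrm x) *\<^sub>R nrm x"] assms by (simp add: tang_def)
qed

text \<open>Once the normal derivative is written as \<open>grad f x \<bullet> nrm x\<close>, the
  tangential gradient is \<open>tang\<close> of the gradient.\<close>

lemma norm_tgrad_le:
  assumes "norm (nrm x) = 1" "f differentiable at x"
  shows "norm (tgrad nrm f x) \<le> 2 * norm (grad f x)"
  using norm_tang_le[of nrm x "grad f", OF assms(1)] normal_deriv_eq_grad[OF assms(2)]
  by (simp add: tang_def tgrad_def)

lemma norm_normal_deriv_le:
  assumes "norm (nrm x) = 1" "f differentiable at x"
  shows "norm (normal_deriv nrm f x) \<le> (\<Sum>i\<in>UNIV. norm (pd i f x))"
proof -
  have "norm (nrm x $ i *\<^sub>R pd i f x) \<le> norm (pd i f x)" for i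
    using component_le_norm_cart[of "nrm x" i] assms(1) by (simp add: mult_left_le_one_le)
  then show ?thesis
    unfolding normal_deriv_eq_sum[OF assms(2)] by (intro sum_norm_le) auto
qed


section \<open>Integrability\<close>

text \<open>Continuity on the compact closure gives a bound, and a bounded open set has finite
  measure.\<close>

lemma integrable_lebesgue_on_closure:
  fixes f :: "real ^ 'd \<Rightarrow> real"
  assumes "open \<Omega>" "bounded \<Omega>" "continuous_on (closure \<Omega>) f"
  shows "integrable (lebesgue_on \<Omega>) f"
proof -
  have lm: "\<Omega> \<in> lmeasurable"
    using assms by (simp add: lmeasurable_open)
  then have sets: "\<Omega> \<in> sets lebesgue" by auto
  interpret finite_measure "lebesgue_on \<Omega>"
    using lm by (rule finite_measure_lebesgue_on)
  have "compact (f ` closure \<Omega>)"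
    using assms by (simp add: compact_continuous_image compact_closure)
  then obtain B where B: "\<And>x. x \<in> closure \<Omega> \<Longrightarrow> norm (f x) \<le> B"
    using compact_imp_bounded[of "f ` closure \<Omega>"] by (auto simp: bounded_iff)
  show ?thesis
  proof (rule integrable_const_bound)
    show "AE x in lebesgue_on \<Omega>. norm (f x) \<le> B"
      using B closure_subset[of \<Omega>] by (intro AE_I2) (auto simp: space_restrict_space)
    show "f \<in> borel_measurable (lebesgue_on \<Omega>)"
      by (intro continuous_imp_measurable_on_sets_lebesgue sets
          continuous_on_subset[OF assms(3) closure_subset])
  qed
qed

lemma space_surface_measure [simp]: "space (surface_measure \<Omega>) = frontier \<Omega>"
  by (simp add: surface_measure_def hausdorff_measure_def space_restrict_space)

text \<open>The Borel sets already form a sigma-algebra, so \<open>measure_of\<close> keeps them,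
  and measurability of continuous functions on the frontier carries over.\<close>

lemma sets_surface_measure [measurable_cong]:
  "sets (surface_measure \<Omega>) = sets (restrict_space borel (frontier \<Omega>))"
  unfolding surface_measure_def hausdorff_measure_def
  by (rule sets_restrict_space_cong) (simp add: sets.sigma_sets_eq[of borel, unfolded space_borel])

lemma borel_measurable_surface_measure:
  "continuous_on (frontier \<Omega>) f \<Longrightarrow> f \<in> borel_measurable (surface_measure \<Omega>)"
  using borel_measurable_continuous_on_restrict measurable_cong_sets[OF sets_surface_measure refl]
  by blast

lemma integrable_surface_measure:
  fixes f :: "real ^ 'd \<Rightarrow> real"
  assumes "finite_measure (surface_measure \<Omega>)" "bounded \<Omega>" "continuous_on (frontier \<Omega>) f"
  shows "integrable (surface_measure \<Omega>) f"
proof -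
  interpret finite_measure "surface_measure \<Omega>" by fact
  have "compact (f ` frontier \<Omega>)"
    using assms by (simp add: compact_continuous_image compact_frontier_bounded)
  then obtain B where B: "\<And>x. x \<in> frontier \<Omega> \<Longrightarrow> norm (f x) \<le> B"
    using compact_imp_bounded[of "f ` frontier \<Omega>"] by (auto simp: bounded_iff)
  show ?thesis
    by (rule integrable_const_bound[of _ B])
      (use B assms(3) in \<open>auto intro: borel_measurable_surface_measure\<close>)
qed


section \<open>The backward difference\<close>

text \<open>The gap between the sides is a square. Working in \<open>real_inner\<close> covers the
  velocities, the phase gradients and the scalars \<open>U\<close> and \<open>W\<close>
  alike.\<close>

lemma bdf2_inequality:
  fixes a b c :: "'a::real_inner"
  shows "(norm a)\<^sup>2 + (norm (2 *\<^sub>R a - b))\<^sup>2 - (norm b)\<^sup>2 - (norm (2 *\<^sub>R b - c))\<^sup>2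
      \<le> 2 * ((3 *\<^sub>R a - 4 *\<^sub>R b + c) \<bullet> a)"
proof -
  have "0 \<le> (norm (a - 2 *\<^sub>R b + c))\<^sup>2" by simp
  then show ?thesis
    unfolding power2_norm_eq_inner
    by (simp add: inner_simps inner_commute[of b a] inner_commute[of c a] inner_commute[of c b])
qed

lemma Ck_upto_1_star:
  "Ck_upto 1 \<Omega> (S (k-1)) \<Longrightarrow> Ck_upto 1 \<Omega> (S (k-2)) \<Longrightarrow> Ck_upto 1 \<Omega> (star S k)"
  unfolding star_def[abs_def] by (intro Ck_upto_1_diff Ck_upto_1_scaleR_const)

lemma Ck_upto_1_bdf:
  "Ck_upto 1 \<Omega> (S k) \<Longrightarrow> Ck_upto 1 \<Omega> (S (k-1)) \<Longrightarrow> Ck_upto 1 \<Omega> (S (k-2)) \<Longrightarrow> Ck_upto 1 \<Omega> (bdf S k)"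
  unfolding bdf_def[abs_def] by (intro Ck_upto_1_diff Ck_upto_1_add Ck_upto_1_scaleR_const)

text \<open>Extrapolation is linear in the time levels and so commutes with the gradient. This
  brings the phase gradients into the form of \<open>bdf2_inequality\<close>.\<close>

lemma grad_star:
  assumes "S (k-1) differentiable at x" "S (k-2) differentiable at x"
  shows "grad (star S k) x = star (\<lambda>m. grad (S m)) k x"
  unfolding star_def[abs_def]
  by (simp only: grad_diff grad_scaleR_const assms differentiable_linear[OF bounded_linear_scaleR_right])

lemma grad_bdf:
  assumes "S k differentiable at x" "S (k-1) differentiable at x" "S (k-2) differentiable at x"
  shows "grad (bdf S k) x = bdf (\<lambda>m. grad (S m)) k x"
  unfolding bdf_def[abs_def]
  by (simp only: grad_diff grad_add grad_scaleR_const assms differentiable_diff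
      differentiable_linear[OF bounded_linear_scaleR_right])

lemma divg_bdf:
  assumes "S k differentiable at x" "S (k-1) differentiable at x" "S (k-2) differentiable at x"
  shows "divg (bdf S k) x = bdf (\<lambda>m. divg (S m)) k x"
  unfolding bdf_def[abs_def] real_scaleR_def
  by (simp only: divg_diff divg_add divg_scaleR_const assms differentiable_diff
      differentiable_linear[OF bounded_linear_scaleR_right])

text \<open>The integrand is nonnegative, hence so is its Bochner integral, which is 0 by convention
  if the integrand is not integrable. Thus the square undoes the root.\<close>

lemma L2_norm_power2: "(L2_norm m f)\<^sup>2 = (LINT x|m. f x \<bullet> f x)"
  by (simp add: L2_norm_def L2_inner_def integral_nonneg_AE)


section \<open>The energy dissipation law\<close>

theorem theorem3p4:
  fixes \<Omega> :: "(real ^ 'd) set" and nrm :: "real ^ 'd \<Rightarrow> real ^ 'd"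
    and M lam \<epsilon> \<nu> \<gamma> \<theta>s C dt :: real
    and l :: "real \<Rightarrow> real" and uw :: "real ^ 'd \<Rightarrow> real ^ 'd"
    and \<phi> p U W :: "nat \<Rightarrow> real ^ 'd \<Rightarrow> real" and u :: "nat \<Rightarrow> real ^ 'd \<Rightarrow> real ^ 'd"
    and \<mu> :: "real ^ 'd \<Rightarrow> real" and ut :: "real ^ 'd \<Rightarrow> real ^ 'd"
    and n :: nat
  assumes dim: "CARD('d) = 2 \<or> CARD('d) = 3"
    and dom: "domain_with_normal \<Omega> nrm"
    and pos: "M > 0" "lam > 0" "\<epsilon> > 0" "\<nu> > 0" "\<gamma> > 0" "dt > 0"
    and l: "\<And>s. l s \<ge> 0" "l \<in> borel_measurable borel"
    and uw: "continuous_on (frontier \<Omega>) uw"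
    and C: "\<And>s. wall_G \<theta>s s + C > 0"
    and n: "n \<ge> 1"
    and smooth: "\<And>k. k \<in> {n-1, n, n+1} \<Longrightarrow>
        Ck_upto 2 \<Omega> (\<phi> k) \<and> Ck_upto 1 \<Omega> (u k) \<and> Ck_upto 1 \<Omega> (p k) \<and>
        continuous_on (closure \<Omega>) (U k) \<and> continuous_on (frontier \<Omega>) (W k)"
      "Ck_upto 2 \<Omega> \<mu>" "Ck_upto 2 \<Omega> ut"
    and previous: "\<And>k x. k \<in> {n-1, n} \<Longrightarrow> x \<in> \<Omega> \<Longrightarrow> divg (u k) x = 0"
      "\<And>k. k \<in> {n-1, n} \<Longrightarrow> AE x in surface_measure \<Omega>. u k x \<bullet> nrm x = 0"
    \<comment> \<open>Step 1 in the domain\<close>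
    and phase: "\<And>x. x \<in> \<Omega> \<Longrightarrow>
        bdf \<phi> (n+1) x / (2*dt) + divg (\<lambda>y. star \<phi> (n+1) y *\<^sub>R ut y) x = M * lap \<mu> x"
    and potential: "\<And>x. x \<in> \<Omega> \<Longrightarrow>
        \<mu> x = lam * (- \<epsilon> * lap (\<phi> (n+1)) x + 1/\<epsilon> * star \<phi> (n+1) x * U (n+1) x)"
    and auxU: "\<And>x. x \<in> \<Omega> \<Longrightarrow> bdf U (n+1) x = 2 * star \<phi> (n+1) x * bdf \<phi> (n+1) x"
    and momentum: "\<And>x. x \<in> \<Omega> \<Longrightarrow>
        (1/(2*dt)) *\<^sub>R (3 *\<^sub>R ut x - 4 *\<^sub>R u n x + u (n-1) x)
        + convect (star u (n+1)) ut x - \<nu> *\<^sub>R lap ut x + grad (p n) x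
        + star \<phi> (n+1) x *\<^sub>R grad \<mu> x = 0"
    \<comment> \<open>Step 1 on the boundary\<close>
    and no_penetration: "AE x in surface_measure \<Omega>. ut x \<bullet> nrm x = 0"
    and slip: "AE x in surface_measure \<Omega>.
        \<nu> *\<^sub>R tang nrm (normal_deriv nrm ut) x =
          - (\<nu> * l (star \<phi> (n+1) x)) *\<^sub>R (ut x - uw x)
          - (lam/\<gamma> * phi_dot nrm dt \<phi> ut (n+1) x) *\<^sub>R tgrad nrm (star \<phi> (n+1)) x"
    and no_flux: "AE x in surface_measure \<Omega>. normal_deriv nrm \<mu> x = 0"
    and contact_line: "AE x in surface_measure \<Omega>.
        \<epsilon> * normal_deriv nrm (\<phi> (n+1)) x =
          - (1/\<gamma>) * phi_dot nrm dt \<phi> ut (n+1) x - wall_Z \<theta>s C (star \<phi> (n+1) x) * W (n+1) x"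
    and auxW: "AE x in surface_measure \<Omega>.
        bdf W (n+1) x = 1/2 * wall_Z \<theta>s C (star \<phi> (n+1) x) * bdf \<phi> (n+1) x"
    \<comment> \<open>Step 2\<close>
    and projection: "\<And>x. x \<in> \<Omega> \<Longrightarrow>
        (3/(2*dt)) *\<^sub>R (u (n+1) x - ut x) + grad (\<lambda>y. p (n+1) y - p n y) x = 0"
      "\<And>x. x \<in> \<Omega> \<Longrightarrow> divg (u (n+1)) x = 0"
      "AE x in surface_measure \<Omega>. u (n+1) x \<bullet> nrm x = 0"
  shows "energy_bdf \<Omega> lam \<epsilon> C dt u \<phi> U W p (n+1) \<le>
      energy_bdf \<Omega> lam \<epsilon> C dt u \<phi> U W p n
      - M * dt * (L2_norm (lebesgue_on \<Omega>) (grad \<mu>))\<^sup>2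
      - \<nu> * dt * (L2_norm (lebesgue_on \<Omega>) (vgrad ut))\<^sup>2
      - lam/\<gamma> * dt * (L2_norm (surface_measure \<Omega>) (phi_dot nrm dt \<phi> ut (n+1)))\<^sup>2
      - \<nu> * dt * (L2_norm (surface_measure \<Omega>)
          (\<lambda>x. sqrt (l (star \<phi> (n+1) x)) *\<^sub>R (ut x - uw x)))\<^sup>2
      - \<nu> * dt * L2_inner (surface_measure \<Omega>)
          (\<lambda>x. l (star \<phi> (n+1) x) *\<^sub>R (ut x - uw x)) uw"
proof -

  \<comment> \<open>Geometry of the domain and smoothness of the data\<close>
  have op: "open \<Omega>" and bd: "bounded \<Omega>" and fin: "finite_measure (surface_measure \<Omega>)"
    and nrm [measurable]: "nrm \<in> borel_measurable (surface_measure \<Omega>)"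
    and unit: "AE x in surface_measure \<Omega>. norm (nrm x) = 1"
    and div_thm: "\<And>F. Ck_upto 1 \<Omega> F \<Longrightarrow>
        (LINT x|lebesgue_on \<Omega>. divg F x) = (LINT x|surface_measure \<Omega>. F x \<bullet> nrm x)"
    using dom unfolding domain_with_normal_def outward_unit_normal_def by auto
  have sub: "\<Omega> \<subseteq> closure \<Omega>" and fsub: "frontier \<Omega> \<subseteq> closure \<Omega>"
    by (auto simp: closure_subset[THEN subsetD] frontier_def)
  let ?\<phi>s = "star \<phi> (n+1)" and ?us = "star u (n+1)" and ?D\<phi> = "bdf \<phi> (n+1)" and ?Du = "bdf u (n+1)"
  let ?q = "\<lambda>y. p (n+1) y - p n y"

  have C\<phi>: "Ck_upto 1 \<Omega> (\<phi> (n+1))" "Ck_upto 1 \<Omega> (\<phi> n)" "Ck_upto 1 \<Omega> (\<phi> (n-1))"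
    and Cu: "Ck_upto 1 \<Omega> (u (n+1))" "Ck_upto 1 \<Omega> (u n)" "Ck_upto 1 \<Omega> (u (n-1))"
    and Cp: "Ck_upto 1 \<Omega> (p (n+1))" "Ck_upto 1 \<Omega> (p n)"
    and cU: "continuous_on (closure \<Omega>) (U (n+1))" "continuous_on (closure \<Omega>) (U n)" "continuous_on (closure \<Omega>) (U (n-1))"
    and cW: "continuous_on (frontier \<Omega>) (W (n+1))" "continuous_on (frontier \<Omega>) (W n)" "continuous_on (frontier \<Omega>) (W (n-1))"
    and C\<phi>2: "Ck_upto 2 \<Omega> (\<phi> (n+1))"
    using smooth(1) by (auto intro: Ck_upto_2_imp_1 simp del: One_nat_def)
  have C\<mu>: "Ck_upto 1 \<Omega> \<mu>" and Cut: "Ck_upto 1 \<Omega> ut"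
    using smooth(2,3) by (auto intro: Ck_upto_2_imp_1 simp del: One_nat_def)
  \<comment> \<open>\<open>star\<close> and \<open>bdf\<close> reach earlier time levels by
    subtraction on \<open>nat\<close>. These are the indices met at levels \<open>n+1\<close> and
    \<open>n+2\<close>.\<close>
  have ix: "n+1-1 = n" "n+1-2 = n-1" "n+1+1-1 = n+1" "n+1+1-2 = n" by auto
  have C\<phi>s: "Ck_upto 1 \<Omega> ?\<phi>s" "Ck_upto 1 \<Omega> (star \<phi> (n+1+1))"
    by (rule Ck_upto_1_star; simp only: ix C\<phi>)+
  have Cus: "Ck_upto 1 \<Omega> ?us" "Ck_upto 1 \<Omega> (star u (n+1+1))"
    by (rule Ck_upto_1_star; simp only: ix Cu)+
  have CD\<phi>: "Ck_upto 1 \<Omega> ?D\<phi>" by (rule Ck_upto_1_bdf; simp only: ix C\<phi>)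
  have CDu: "Ck_upto 1 \<Omega> ?Du" by (rule Ck_upto_1_bdf; simp only: ix Cu)
  have Cq: "Ck_upto 1 \<Omega> ?q" by (intro Ck_upto_1_diff Cp)

  \<comment> \<open>The combined flux and the energy increments\<close>
  define F1 where "F1 = (\<lambda>y. ?D\<phi> y *\<^sub>R grad (\<phi> (n+1)) y)"
  define F2 where "F2 = (\<lambda>y. \<mu> y *\<^sub>R grad \<mu> y)"
  define F3 where "F3 = (\<lambda>y. \<mu> y *\<^sub>R (?\<phi>s y *\<^sub>R ut y))"
  define F4 where "F4 = (\<lambda>y. (ut y \<bullet> ut y) *\<^sub>R ?us y)"
  define F5 where "F5 = vgrad_flux ut"
  define F6 where "F6 = (\<lambda>y. ?q y *\<^sub>R ?Du y)"
  define F7 where "F7 = (\<lambda>y. p (n+1) y *\<^sub>R u (n+1) y)"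
  have CF: "Ck_upto 1 \<Omega> F1" "Ck_upto 1 \<Omega> F2" "Ck_upto 1 \<Omega> F3" "Ck_upto 1 \<Omega> F4"
    "Ck_upto 1 \<Omega> F5" "Ck_upto 1 \<Omega> F6" "Ck_upto 1 \<Omega> F7"
    unfolding F1_def F2_def F3_def F4_def F5_def F6_def F7_def
    by (intro Ck_upto_1_scaleR Ck_upto_1_inner Ck_upto_2_grad Ck_upto_1_vgrad_flux
        C\<phi> Cu Cp C\<phi>2 C\<mu> Cut C\<phi>s Cus CD\<phi> CDu Cq smooth(2,3))+
  \<comment> \<open>The weights correspond to testing the potential equation with half of
    \<open>?D\<phi>\<close>, the phase equation with \<open>dt * \<mu>\<close> and the momentum
    equation with \<open>dt *\<^sub>R ut\<close>. \<open>F6\<close> and \<open>F7\<close> arise when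
    \<open>ut\<close> is eliminated through the projection step.\<close>
  define F where "F = (\<lambda>y. (lam*\<epsilon>/2) *\<^sub>R F1 y + (M*dt) *\<^sub>R F2 y + (-dt) *\<^sub>R F3 y + (-dt/2) *\<^sub>R F4 y
      + (\<nu>*dt) *\<^sub>R F5 y + (-dt/3) *\<^sub>R F6 y + (-dt) *\<^sub>R F7 y)"
  have CF': "Ck_upto 1 \<Omega> F"
    unfolding F_def by (intro Ck_upto_1_add Ck_upto_1_scaleR_const CF)

  define dens where "dens v f h x = (1/2) * (norm (v x))\<^sup>2
      + lam * (\<epsilon>/2 * (norm (grad f x))\<^sup>2 + 1/(4*\<epsilon>) * (h x)\<^sup>2)"
    for v :: "real ^ 'd \<Rightarrow> real ^ 'd" and f h :: "real ^ 'd \<Rightarrow> real" and x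
  \<comment> \<open>\<open>e\<close> and \<open>w\<close> are the bulk and wall densities of the
    increment of \<open>energy_bdf\<close>; the constant with \<open>C\<close> cancels between the
    two time levels.\<close>
  define e where "e x = 1/2 * dens (u (n+1)) (\<phi> (n+1)) (U (n+1)) x
      + 1/2 * dens (star u (n+1+1)) (star \<phi> (n+1+1)) (star U (n+1+1)) x
      + dt\<^sup>2/3 * (grad (p (n+1)) x \<bullet> grad (p (n+1)) x)
      - 1/2 * dens (u n) (\<phi> n) (U n) x
      - 1/2 * dens (star u (n+1)) (star \<phi> (n+1)) (star U (n+1)) x
      - dt\<^sup>2/3 * (grad (p n) x \<bullet> grad (p n) x)" for x
  define w where "w x = lam/2 * ((W (n+1) x)\<^sup>2 + (star W (n+1+1) x)\<^sup>2 - (W n x)\<^sup>2 - (star W (n+1) x)\<^sup>2)" for x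
  define H where "H x = l (?\<phi>s x) *\<^sub>R (ut x - uw x)" for x

  \<comment> \<open>Pointwise inequality in the domain\<close>
  have interior: "e x + M*dt*(grad \<mu> x \<bullet> grad \<mu> x) + \<nu>*dt*(vgrad ut x \<bullet> vgrad ut x) \<le> divg F x"
    if x: "x \<in> \<Omega>" for x
  proof -
    have xc: "x \<in> closure \<Omega>" using x sub by blast
    note d = Ck_upto_1_differentiable[OF _ xc]
    have d\<phi>: "\<phi> (n+1+1-1) differentiable at x" "\<phi> (n+1+1-2) differentiable at x"
      "\<phi> (n+1-1) differentiable at x" "\<phi> (n+1-2) differentiable at x"
      unfolding ix by (intro d C\<phi>)+
    have dcF: "(\<lambda>y. c *\<^sub>R G y) differentiable at x" if "Ck_upto 1 \<Omega> G" for c and G :: "real ^ 'd \<Rightarrow> real ^ 'd"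
      by (rule d[OF Ck_upto_1_scaleR_const[OF that]])
    have dF: "divg F x = lam*\<epsilon>/2 * divg F1 x + M*dt * divg F2 x - dt * divg F3 x - dt/2 * divg F4 x
        + \<nu>*dt * divg F5 x - dt/3 * divg F6 x - dt * divg F7 x"
      unfolding F_def
      by (simp only: divg_add divg_scaleR_const differentiable_add dcF d CF)
    define G1 G0 Gm where "G1 = grad (\<phi> (n+1)) x" and "G0 = grad (\<phi> n) x" and "Gm = grad (\<phi> (n-1)) x"
    define a b c where "a = u (n+1) x" and "b = u n x" and "c = u (n-1) x"
    define P1 P0 where "P1 = grad (p (n+1)) x" and "P0 = grad (p n) x"
    define D where "D = 3 *\<^sub>R a - 4 *\<^sub>R b + c"
    define DG where "DG = 3 *\<^sub>R G1 - 4 *\<^sub>R G0 + Gm"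
    define Df where "Df = ?D\<phi> x"
    define f where "f = ?\<phi>s x"
    define DU where "DU = bdf U (n+1) x"
    \<comment> \<open>With \<open>1/\<epsilon>\<close> as a single atom, the coefficients of energy
      and potential become multiples of one another for the final linear arithmetic.\<close>
    define ie where "ie = 1/\<epsilon>"
    have ie: "1/(4*\<epsilon>) = ie/4" "1/\<epsilon> = ie" and ie0: "ie > 0"
      using pos by (simp_all add: ie_def)
    have gs: "grad (star \<phi> (n+1)) x = 2 *\<^sub>R G0 - Gm" "grad (star \<phi> (n+1+1)) x = 2 *\<^sub>R G1 - G0"
      using grad_star[OF d\<phi>(3,4)] grad_star[OF d\<phi>(1,2)]
      by (simp_all add: star_def G1_def G0_def Gm_def)
    have gD: "grad ?D\<phi> x = DG"
      using grad_bdf[OF d[OF C\<phi>(1)] d\<phi>(3,4)] by (simp add: bdf_def DG_def G1_def G0_def Gm_def)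
    \<comment> \<open>All three velocities are solenoidal, so the divergence of \<open>F6\<close>
      retains only the pressure gradient term.\<close>
    have dD: "divg ?Du x = 0"
      using divg_bdf[of u "n+1" x] d[OF Cu(1)] d[OF Cu(2)] d[OF Cu(3)]
        projection(2)[OF x] previous(1)[OF _ x, of n] previous(1)[OF _ x, of "n-1"]
      by (simp add: bdf_def)
    have Dux: "?Du x = D" by (simp add: bdf_def D_def a_def b_def c_def)
    have gq: "grad ?q x = P1 - P0"
      using grad_diff[OF d[OF Cp(1)] d[OF Cp(2)]] by (simp add: P1_def P0_def)
    have I1: "(norm a)\<^sup>2 + (norm (2 *\<^sub>R a - b))\<^sup>2 - (norm b)\<^sup>2 - (norm (2 *\<^sub>R b - c))\<^sup>2 \<le> 2 * (D \<bullet> a)"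
      unfolding D_def by (rule bdf2_inequality)
    \<comment> \<open>The factors \<open>lam*\<epsilon>/4\<close> and \<open>lam*ie/8\<close> below
      are the weights in \<open>energy\<close>, halved by the averaging in
      \<open>energy_bdf\<close>.\<close>
    have "(norm G1)\<^sup>2 + (norm (2 *\<^sub>R G1 - G0))\<^sup>2 - (norm G0)\<^sup>2 - (norm (2 *\<^sub>R G0 - Gm))\<^sup>2 \<le> 2 * (DG \<bullet> G1)"
      unfolding DG_def by (rule bdf2_inequality)
    then have I2: "lam*\<epsilon>/4 * ((norm G1)\<^sup>2 + (norm (2 *\<^sub>R G1 - G0))\<^sup>2 - (norm G0)\<^sup>2 - (norm (2 *\<^sub>R G0 - Gm))\<^sup>2)
        \<le> lam*\<epsilon>/4 * (2 * (DG \<bullet> G1))"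
      using pos by (intro mult_left_mono) auto
    have "(U (n+1) x)\<^sup>2 + (star U (n+1+1) x)\<^sup>2 - (U n x)\<^sup>2 - (star U (n+1) x)\<^sup>2 \<le> 2 * (DU * U (n+1) x)"
      using bdf2_inequality[of "U (n+1) x" "U n x" "U (n-1) x"] by (simp add: star_def bdf_def DU_def)
    then have I3: "lam*ie/8 * ((U (n+1) x)\<^sup>2 + (star U (n+1+1) x)\<^sup>2 - (U n x)\<^sup>2 - (star U (n+1) x)\<^sup>2)
        \<le> lam*ie/8 * (2 * (DU * U (n+1) x))"
      using pos ie0 by (intro mult_left_mono) auto
    have e_le: "e x \<le> 1/2 * (D \<bullet> a) + lam*\<epsilon>/2 * (DG \<bullet> G1) + lam*ie/4 * (DU * U (n+1) x)
        + dt\<^sup>2/3 * (P1 \<bullet> P1 - P0 \<bullet> P0)"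
    proof -
      have s: "star u (n+1+1) x = 2 *\<^sub>R a - b" "star u (n+1) x = 2 *\<^sub>R b - c"
        by (simp_all add: star_def a_def b_def c_def)
      show ?thesis
        using I1 I2 I3 unfolding e_def dens_def gs s ie G1_def[symmetric] G0_def[symmetric]
          a_def[symmetric] b_def[symmetric] P1_def[symmetric] P0_def[symmetric]
        by (simp add: algebra_simps add_divide_distrib diff_divide_distrib)
    qed
    \<comment> \<open>The equation for \<open>U\<close> turns its increment into half of the last
      term of \<open>k1\<close>.\<close>
    have U1: "lam*ie/4 * (DU * U (n+1) x) = lam*ie/2 * (f * Df * U (n+1) x)"
      using auxU[OF x] by (simp add: DU_def f_def Df_def)
    have dF1: "divg F1 x = DG \<bullet> G1 + Df * lap (\<phi> (n+1)) x"
      unfolding F1_def using divg_scaleR[OF d[OF CD\<phi>] d[OF Ck_upto_2_grad[OF C\<phi>2]]]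
        divg_grad[OF d[OF Ck_upto_2_pd[OF C\<phi>2]]] gD by (simp add: Df_def G1_def)
    have dF2: "divg F2 x = grad \<mu> x \<bullet> grad \<mu> x + \<mu> x * lap \<mu> x"
      unfolding F2_def using divg_scaleR[OF d[OF C\<mu>] d[OF Ck_upto_2_grad[OF smooth(2)]]]
        divg_grad[OF d[OF Ck_upto_2_pd[OF smooth(2)]]] by simp
    define T where "T = divg (\<lambda>y. ?\<phi>s y *\<^sub>R ut y) x"
    have dF3: "divg F3 x = f * (grad \<mu> x \<bullet> ut x) + \<mu> x * T"
      unfolding F3_def using divg_scaleR[OF d[OF C\<mu>] d[OF Ck_upto_1_scaleR[OF C\<phi>s(1) Cut]]]
      by (simp add: T_def f_def)
    have dF4: "divg F4 x = 2 * (convect ?us ut x \<bullet> ut x)"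
      unfolding F4_def using convect_inner_self[OF d[OF Cus(1)] d[OF Cut]] by simp
    have dF5: "divg F5 x = lap ut x \<bullet> ut x + vgrad ut x \<bullet> vgrad ut x"
      unfolding F5_def by (rule divg_vgrad_flux[OF d[OF Cut] d[OF Ck_upto_2_pd[OF smooth(3)]]])
    have dF6: "divg F6 x = (P1 - P0) \<bullet> D"
      unfolding F6_def using divg_scaleR[OF d[OF Cq] d[OF CDu]] gq dD Dux by simp
    have dF7: "divg F7 x = P1 \<bullet> a"
      unfolding F7_def using divg_scaleR[OF d[OF Cp(1)] d[OF Cu(1)]] projection(2)[OF x]
      by (simp add: a_def P1_def)
    \<comment> \<open>\<open>Df * \<mu> x\<close> is computed twice, here from the potential and in
      \<open>k2\<close> from the phase equation; comparing the two links the free energy to the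
      dissipation.\<close>
    have k1: "Df * \<mu> x = - (lam*\<epsilon>) * (Df * lap (\<phi> (n+1)) x) + lam*ie*(f * Df * U (n+1) x)"
      by (subst potential[OF x]) (simp add: ie f_def algebra_simps)
    have "Df / (2*dt) = M * lap \<mu> x - T"
      using phase[OF x] by (simp add: Df_def T_def)
    then have "Df = 2*dt*(M * lap \<mu> x - T)"
      using pos(6) by (simp add: field_simps)
    then have k2: "Df * \<mu> x = 2*dt*M*(\<mu> x * lap \<mu> x) - 2*dt*(\<mu> x * T)"
      by (simp only:) (simp add: algebra_simps)
    \<comment> \<open>Scaling the projection equation by \<open>2*dt/3\<close> solves it for
      \<open>ut\<close>.\<close>
    have "(2*dt/3) *\<^sub>R ((3/(2*dt)) *\<^sub>R (a - ut x) + (P1 - P0)) = 0"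
      using projection(1)[OF x] unfolding gq by (simp add: a_def)
    then have ut: "ut x = a + (2*dt/3) *\<^sub>R (P1 - P0)"
      using pos(6) by (simp add: scaleR_add_right algebra_simps)
    have "(1/(2*dt)) * ((3 *\<^sub>R ut x - 4 *\<^sub>R b + c) \<bullet> ut x) + convect ?us ut x \<bullet> ut x - \<nu> * (lap ut x \<bullet> ut x)
        + P0 \<bullet> ut x + f * (grad \<mu> x \<bullet> ut x) = 0"
      using arg_cong[OF momentum[OF x], of "\<lambda>v. v \<bullet> ut x"]
      by (simp add: inner_add_left inner_diff_left b_def c_def P0_def f_def)
    then have "dt * ((1/(2*dt)) * ((3 *\<^sub>R ut x - 4 *\<^sub>R b + c) \<bullet> ut x) + convect ?us ut x \<bullet> ut x - \<nu> * (lap ut x \<bullet> ut x)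
        + P0 \<bullet> ut x + f * (grad \<mu> x \<bullet> ut x)) = 0" by simp
    then have mom: "1/2 * ((3 *\<^sub>R ut x - 4 *\<^sub>R b + c) \<bullet> ut x) + dt * (convect ?us ut x \<bullet> ut x)
        - dt * \<nu> * (lap ut x \<bullet> ut x) + dt * (P0 \<bullet> ut x) + dt * f * (grad \<mu> x \<bullet> ut x) = 0"
      using pos(6) by (simp add: algebra_simps)
    \<comment> \<open>Eliminating \<open>ut\<close> from the tested momentum equation leaves
      \<open>D \<bullet> a\<close> for the kinetic energy, the divergences of \<open>F6\<close> and
      \<open>F7\<close>, and products of pressure gradients. The term \<open>P0 \<bullet> a\<close>
      cancels against \<open>m2\<close>.\<close>
    have "3 *\<^sub>R ut x - 4 *\<^sub>R b + c = D + (2*dt) *\<^sub>R (P1 - P0)"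
      unfolding ut D_def by (simp add: algebra_simps)
    then have m1: "(3 *\<^sub>R ut x - 4 *\<^sub>R b + c) \<bullet> ut x = D \<bullet> a + (2*dt/3) * ((P1 - P0) \<bullet> D)
        + 2*dt*(P1 \<bullet> a - P0 \<bullet> a) + 4*dt\<^sup>2/3 * ((P1 - P0) \<bullet> (P1 - P0))"
      by (simp only:) (simp add: ut inner_simps inner_commute power2_eq_square algebra_simps add_divide_distrib diff_divide_distrib)
    have m2: "P0 \<bullet> ut x = P0 \<bullet> a + (2*dt/3) * (P0 \<bullet> (P1 - P0))"
      by (simp add: ut inner_simps)
    have m3: "P1 \<bullet> P1 - P0 \<bullet> P0 = 2 * (P0 \<bullet> (P1 - P0)) + (P1 - P0) \<bullet> (P1 - P0)"
      by (simp add: inner_simps inner_commute)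
    \<comment> \<open>After the mixed terms of \<open>m2\<close> and \<open>m3\<close> cancel, the
      pressure increment has coefficient \<open>2*dt\<^sup>2/3\<close> from \<open>m1\<close>
      against \<open>dt\<^sup>2/3\<close> from \<open>m3\<close>. The surplus has the dissipative
      sign and is discarded.\<close>
    have m4: "0 \<le> dt\<^sup>2 * ((P1 - P0) \<bullet> (P1 - P0))" by simp
    show ?thesis
      using e_le mom k1 k2 m4 unfolding dF dF1 dF2 dF3 dF4 dF5 dF6 dF7 m1 m2 m3 U1
      by (simp add: algebra_simps power2_eq_square add_divide_distrib diff_divide_distrib)
  qed

  \<comment> \<open>Inequality almost everywhere on the wall\<close>
  have boundary: "AE x in surface_measure \<Omega>. w x + lam/\<gamma>*dt*(phi_dot nrm dt \<phi> ut (n+1) x * phi_dot nrm dt \<phi> ut (n+1) x)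
      + \<nu>*dt*(H x \<bullet> (ut x - uw x)) + \<nu>*dt*(H x \<bullet> uw x) \<le> - (F x \<bullet> nrm x)"
    using AE_space unit no_penetration slip no_flux contact_line auxW projection(3)
      previous(2)[of n, simplified] previous(2)[of "n-1", simplified]
  proof eventually_elim
    case (elim x)
    then have xc: "x \<in> closure \<Omega>" using fsub by auto
    note d = Ck_upto_1_differentiable[OF _ xc]
    define Pd where "Pd = phi_dot nrm dt \<phi> ut (n+1) x"
    define N where "N = normal_deriv nrm ut x"
    define Nf where "Nf = normal_deriv nrm (\<phi> (n+1)) x"
    define t where "t = ut x \<bullet> tgrad nrm ?\<phi>s x"
    define Z where "Z = wall_Z \<theta>s C (?\<phi>s x)"
    define Df where "Df = ?D\<phi> x"
    have tang: "tang nrm ut x = ut x" using elim by (simp add: tang_def)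
    \<comment> \<open>These fluxes are carried by velocities, or combinations of them, that are
      tangent to the wall.\<close>
    have n0: "F3 x \<bullet> nrm x = 0" "F4 x \<bullet> nrm x = 0" "F6 x \<bullet> nrm x = 0" "F7 x \<bullet> nrm x = 0"
      using elim by (simp_all add: F3_def F4_def F6_def F7_def star_def bdf_def inner_simps)
    have n1: "F1 x \<bullet> nrm x = Df * Nf" "F2 x \<bullet> nrm x = 0" "F5 x \<bullet> nrm x = N \<bullet> ut x"
      using elim normal_deriv_eq_grad[OF d[OF C\<phi>(1)], of nrm] normal_deriv_eq_grad[OF d[OF C\<mu>], of nrm]
        vgrad_flux_inner_normal[OF d[OF Cut], of nrm]
      by (simp_all add: F1_def F2_def F5_def Df_def Nf_def N_def)
    have Fn: "F x \<bullet> nrm x = lam*\<epsilon>/2 * (Df * Nf) + \<nu>*dt * (N \<bullet> ut x)"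
      by (simp add: F_def inner_add_left inner_diff_left n0 n1)
    \<comment> \<open>Since \<open>ut\<close> is tangential, testing with it does not see the normal
      part of the normal derivative.\<close>
    have "tang nrm (normal_deriv nrm ut) x \<bullet> ut x = N \<bullet> ut x"
      using elim by (simp add: tang_def N_def inner_diff_left inner_diff_right inner_commute)
    then have s: "\<nu> * (N \<bullet> ut x) = - \<nu> * (H x \<bullet> ut x) - lam/\<gamma> * Pd * t"
      using arg_cong[OF elim(4), of "\<lambda>v. v \<bullet> ut x"]
      by (simp add: inner_diff_left inner_diff_right H_def Pd_def t_def inner_commute)
    have cl: "\<epsilon> * Nf = - (1/\<gamma>) * Pd - Z * W (n+1) x"
      using elim by (simp add: Nf_def Pd_def Z_def)
    \<comment> \<open>Solving for \<open>Df\<close> splits \<open>Pd * Df\<close> into the contact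
      line dissipation and a multiple of \<open>Pd * t\<close>. The latter cancels against the
      capillary term of the slip condition in \<open>s\<close>.\<close>
    have "Pd = Df / (2*dt) + t"
      by (simp add: Pd_def phi_dot_def tang Df_def t_def)
    then have Df: "Df = 2*dt*Pd - 2*dt*t"
      using pos(6) by (simp add: field_simps)
    have "(W (n+1) x)\<^sup>2 + (star W (n+1+1) x)\<^sup>2 - (W n x)\<^sup>2 - (star W (n+1) x)\<^sup>2 \<le> 2 * (bdf W (n+1) x * W (n+1) x)"
      using bdf2_inequality[of "W (n+1) x" "W n x" "W (n-1) x"] by (simp add: star_def bdf_def)
    then have "w x \<le> lam/2 * (2 * (bdf W (n+1) x * W (n+1) x))"
      unfolding w_def using pos(2) by (intro mult_left_mono) auto
    also have "\<dots> = lam/2 * (Z * W (n+1) x * Df)"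
      using elim(7) by (simp add: Z_def Df_def)
    finally have w: "w x \<le> lam/2 * (Z * W (n+1) x * Df)" .
    \<comment> \<open>The contact line condition enters here; its \<open>Z\<close>-term is the
      opposite of the bound on \<open>w x\<close>.\<close>
    have "lam*\<epsilon>/2 * (Df * Nf) = lam/2 * Df * (\<epsilon> * Nf)" by simp
    also have "\<dots> = - lam/2 * (1/\<gamma>) * Pd * Df - lam/2 * (Z * W (n+1) x * Df)"
      unfolding cl by (simp add: algebra_simps)
    also have "- lam/2 * (1/\<gamma>) * Pd * Df = - (lam/\<gamma>*dt*(Pd*Pd)) + dt * (lam/\<gamma> * Pd * t)"
      unfolding Df by (simp add: algebra_simps)
    finally have f: "lam*\<epsilon>/2 * (Df * Nf) = - (lam/\<gamma>*dt*(Pd*Pd)) + dt * (lam/\<gamma> * Pd * t)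
      - lam/2 * (Z * W (n+1) x * Df)" .
    have "\<nu>*dt * (N \<bullet> ut x) = dt * (\<nu> * (N \<bullet> ut x))" by simp
    also have "\<dots> = - (\<nu>*dt* (H x \<bullet> ut x)) - dt * (lam/\<gamma> * Pd * t)"
      unfolding s by (simp add: algebra_simps)
    finally have g: "\<nu>*dt * (N \<bullet> ut x) = - (\<nu>*dt* (H x \<bullet> ut x)) - dt * (lam/\<gamma> * Pd * t)" .
    have "\<nu>*dt*(H x \<bullet> (ut x - uw x)) + \<nu>*dt*(H x \<bullet> uw x) = \<nu>*dt*(H x \<bullet> ut x)"
      by (simp add: inner_diff_right algebra_simps)
    then show ?case
      using w f g unfolding Fn Pd_def[symmetric] by linarith
  qed

  \<comment> \<open>Integration over the domain\<close>
  have int\<Omega>: "integrable (lebesgue_on \<Omega>) h" if "continuous_on (closure \<Omega>) h" for h :: "real ^ 'd \<Rightarrow> real"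
    using op bd that by (rule integrable_lebesgue_on_closure)
  have int\<Gamma>: "integrable (surface_measure \<Omega>) h" if "continuous_on (frontier \<Omega>) h" for h :: "real ^ 'd \<Rightarrow> real"
    using fin bd that by (rule integrable_surface_measure)
  have cf: "continuous_on (frontier \<Omega>) h" if "continuous_on (closure \<Omega>) h" for h :: "real ^ 'd \<Rightarrow> 'z::topological_space"
    using that fsub by (rule continuous_on_subset)

  have cstar: "continuous_on (closure \<Omega>) (star U (n+1))" "continuous_on (closure \<Omega>) (star U (n+1+1))"
    "continuous_on (frontier \<Omega>) (star W (n+1))" "continuous_on (frontier \<Omega>) (star W (n+1+1))"
    unfolding star_def[abs_def] ix by (intro continuous_intros cU cW)+
  have idens: "integrable (lebesgue_on \<Omega>) (dens v f h)"
    if "Ck_upto 1 \<Omega> v" "Ck_upto 1 \<Omega> f" "continuous_on (closure \<Omega>) h" for v f h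
    unfolding dens_def[abs_def]
    by (intro int\<Omega> continuous_intros Ck_upto_1_continuous[OF that(1)]
        Ck_upto_1_continuous_grad[OF that(2)] that(3))
  note idens = idens[OF Cu(1) C\<phi>(1) cU(1)] idens[OF Cu(2) C\<phi>(2) cU(2)]
    idens[OF Cus(1) C\<phi>s(1) cstar(1)] idens[OF Cus(2) C\<phi>s(2) cstar(2)]
  have igrad: "integrable (lebesgue_on \<Omega>) (\<lambda>x. grad f x \<bullet> grad f x)" if "Ck_upto 1 \<Omega> f" for f
    by (intro int\<Omega> continuous_intros Ck_upto_1_continuous_grad that)
  have iv: "integrable (lebesgue_on \<Omega>) (\<lambda>x. vgrad ut x \<bullet> vgrad ut x)"
    by (intro int\<Omega> continuous_on_vgrad_inner_self Cut)
  have ie: "integrable (lebesgue_on \<Omega>) e"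
    unfolding e_def[abs_def]
    by (intro Bochner_Integration.integrable_add Bochner_Integration.integrable_diff
        integrable_mult_right idens igrad Cp)
  have idiv: "integrable (lebesgue_on \<Omega>) (divg F)"
    unfolding divg_def[abs_def] by (intro int\<Omega> continuous_intros Ck_upto_1_continuous_pd CF')
  have "(LINT x|lebesgue_on \<Omega>. e x + M*dt*(grad \<mu> x \<bullet> grad \<mu> x) + \<nu>*dt*(vgrad ut x \<bullet> vgrad ut x))
      \<le> (LINT x|lebesgue_on \<Omega>. divg F x)"
    using interior by (intro integral_mono Bochner_Integration.integrable_add integrable_mult_right
        ie igrad C\<mu> iv idiv) (auto simp: space_restrict_space)
  then have int_le: "(LINT x|lebesgue_on \<Omega>. e x) + M*dt*(L2_norm (lebesgue_on \<Omega>) (grad \<mu>))\<^sup>2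
      + \<nu>*dt*(L2_norm (lebesgue_on \<Omega>) (vgrad ut))\<^sup>2 \<le> (LINT x|surface_measure \<Omega>. F x \<bullet> nrm x)"
    unfolding L2_norm_power2 div_thm[OF CF', symmetric]
    by (simp add: ie iv igrad[OF C\<mu>])

  \<comment> \<open>Integrability and integration on the wall\<close>
  define Pd where "Pd = phi_dot nrm dt \<phi> ut (n+1)"
  \<comment> \<open>\<open>Q\<close> is a continuous substitute for \<open>Pd\<close>, free of the
    merely measurable normal. They agree almost everywhere because a tangential \<open>ut\<close>
    pairs equally with the full and the tangential gradient.\<close>
  define Q where "Q x = ?D\<phi> x / (2*dt) + ut x \<bullet> grad ?\<phi>s x" for x
  \<comment> \<open>\<open>R\<close> is a continuous bound for \<open>H\<close>: the slip condition
    is divided by \<open>\<nu>\<close>, and both factors 2 come from the bounds on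
    \<open>tang\<close> and \<open>tgrad\<close>.\<close>
  define R where "R x = 2 * (\<Sum>i\<in>UNIV. norm (pd i ut x))
      + lam/(\<gamma>*\<nu>) * \<bar>Q x\<bar> * (2 * norm (grad ?\<phi>s x))" for x
  have cut: "continuous_on (frontier \<Omega>) ut" by (intro cf Ck_upto_1_continuous Cut)
  have cQ: "continuous_on (frontier \<Omega>) Q"
    unfolding Q_def[abs_def] using pos(6)
    by (intro cf continuous_intros Ck_upto_1_continuous Ck_upto_1_continuous_grad CD\<phi> C\<phi>s Cut) auto
  have cR: "continuous_on (frontier \<Omega>) R"
    unfolding R_def[abs_def]
    by (intro continuous_intros cQ cf Ck_upto_1_continuous_pd Ck_upto_1_continuous_grad C\<phi>s Cut)
  have [measurable]: "ut \<in> borel_measurable (surface_measure \<Omega>)"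
    "uw \<in> borel_measurable (surface_measure \<Omega>)"
    "?\<phi>s \<in> borel_measurable (surface_measure \<Omega>)"
    "grad ?\<phi>s \<in> borel_measurable (surface_measure \<Omega>)"
    "?D\<phi> \<in> borel_measurable (surface_measure \<Omega>)"
    "F \<in> borel_measurable (surface_measure \<Omega>)"
    by (intro borel_measurable_surface_measure cf Ck_upto_1_continuous Ck_upto_1_continuous_grad
        CD\<phi> C\<phi>s Cut uw CF')+
  have [measurable]: "l \<in> borel_measurable borel" by (rule l(2))
  have nd: "normal_deriv nrm ?\<phi>s x = grad ?\<phi>s x \<bullet> nrm x" if "x \<in> frontier \<Omega>" for x
    using that fsub by (intro normal_deriv_eq_grad Ck_upto_1_differentiable[OF C\<phi>s(1)]) auto
  have Pd_meas [measurable]: "Pd \<in> borel_measurable (surface_measure \<Omega>)"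
  proof -
    \<comment> \<open>On the frontier the normal derivative is the gradient paired with the normal,
      so \<open>Pd\<close> is an algebraic expression in continuous functions and
      \<open>nrm\<close>.\<close>
    have "Pd \<in> borel_measurable (surface_measure \<Omega>) \<longleftrightarrow> (\<lambda>x. ?D\<phi> x / (2*dt)
      + (ut x - (ut x \<bullet> nrm x) *\<^sub>R nrm x) \<bullet> (grad ?\<phi>s x - (grad ?\<phi>s x \<bullet> nrm x) *\<^sub>R nrm x))
      \<in> borel_measurable (surface_measure \<Omega>)"
      by (rule measurable_cong) (simp add: Pd_def phi_dot_def tang_def tgrad_def nd[simplified])
    then show ?thesis by (rule iffD2) measurable
  qed
  have Pd_eq: "AE x in surface_measure \<Omega>. Pd x = Q x"
    using AE_space no_penetration
    by eventually_elim
      (simp add: Pd_def Q_def phi_dot_def tang_def tgrad_def nd[simplified] inner_diff_right)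
  have H_meas [measurable]: "H \<in> borel_measurable (surface_measure \<Omega>)"
    unfolding H_def[abs_def] by measurable
  \<comment> \<open>\<open>l\<close> is only measurable, possibly unbounded; it is the slip condition that makes \<open>H\<close> bounded.\<close>
  have H_le: "AE x in surface_measure \<Omega>. norm (H x) \<le> R x"
    using AE_space unit slip Pd_eq
  proof eventually_elim
    case (elim x)
    then have xc: "x \<in> closure \<Omega>" using fsub by auto
    note d = Ck_upto_1_differentiable[OF _ xc]
    have "\<nu> *\<^sub>R H x = - (\<nu> *\<^sub>R (tang nrm (normal_deriv nrm ut) x + (lam/(\<gamma>*\<nu>) * Q x) *\<^sub>R tgrad nrm ?\<phi>s x))"
      using elim(3,4) pos(4) by (simp add: H_def Pd_def scaleR_add_right)
    then have "H x = - (tang nrm (normal_deriv nrm ut) x + (lam/(\<gamma>*\<nu>) * Q x) *\<^sub>R tgrad nrm ?\<phi>s x)"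
      using pos(4) by (metis less_irrefl scaleR_cancel_left scaleR_minus_right)
    then have "norm (H x) = norm (tang nrm (normal_deriv nrm ut) x + (lam/(\<gamma>*\<nu>) * Q x) *\<^sub>R tgrad nrm ?\<phi>s x)"
      by (simp only: norm_minus_cancel)
    then have "norm (H x) \<le> norm (tang nrm (normal_deriv nrm ut) x)
        + lam/(\<gamma>*\<nu>) * \<bar>Q x\<bar> * norm (tgrad nrm ?\<phi>s x)"
      using norm_triangle_ineq[of "tang nrm (normal_deriv nrm ut) x" "(lam/(\<gamma>*\<nu>) * Q x) *\<^sub>R tgrad nrm ?\<phi>s x"] pos
      by (simp add: abs_mult)
    also have "\<dots> \<le> R x"
      unfolding R_def using elim(2) pos norm_tang_le[of nrm x "normal_deriv nrm ut"]
        norm_normal_deriv_le[of nrm x, OF elim(2) d[OF Cut]] norm_tgrad_le[of nrm x, OF elim(2) d[OF C\<phi>s(1)]]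
      by (intro add_mono mult_left_mono) auto
    finally show ?case .
  qed
  have iH: "integrable (surface_measure \<Omega>) (\<lambda>x. H x \<bullet> v x)" if "continuous_on (frontier \<Omega>) v" for v
  proof (rule Bochner_Integration.integrable_bound)
    show "integrable (surface_measure \<Omega>) (\<lambda>x. R x * norm (v x))"
      by (intro int\<Gamma> continuous_intros cR that)
    have [measurable]: "v \<in> borel_measurable (surface_measure \<Omega>)"
      using that by (rule borel_measurable_surface_measure)
    show "(\<lambda>x. H x \<bullet> v x) \<in> borel_measurable (surface_measure \<Omega>)" by measurable
    show "AE x in surface_measure \<Omega>. norm (H x \<bullet> v x) \<le> norm (R x * norm (v x))"
      using H_le
    proof eventually_elim
      case (elim x)
      have "norm (H x \<bullet> v x) \<le> norm (H x) * norm (v x)"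
        by (simp add: Cauchy_Schwarz_ineq2)
      also have "\<dots> \<le> R x * norm (v x)" using elim by (intro mult_right_mono) auto
      finally show ?case by simp
    qed
  qed
  have iPd: "integrable (surface_measure \<Omega>) (\<lambda>x. Pd x * Pd x)"
  proof -
    have i: "integrable (surface_measure \<Omega>) (\<lambda>x. Q x * Q x)"
      by (intro int\<Gamma> continuous_intros cQ)
    have ae: "AE x in surface_measure \<Omega>. Q x * Q x = Pd x * Pd x"
      using Pd_eq by eventually_elim simp
    show ?thesis by (rule integrable_cong_AE_imp[OF i _ ae]) measurable
  qed
  have iW: "integrable (surface_measure \<Omega>) (\<lambda>x. (W (n+1) x)\<^sup>2)" "integrable (surface_measure \<Omega>) (\<lambda>x. (W n x)\<^sup>2)"
    "integrable (surface_measure \<Omega>) (\<lambda>x. (star W (n+1) x)\<^sup>2)" "integrable (surface_measure \<Omega>) (\<lambda>x. (star W (n+1+1) x)\<^sup>2)"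
    by (intro int\<Gamma> continuous_intros cW cstar)+
  have iw: "integrable (surface_measure \<Omega>) w"
    unfolding w_def[abs_def]
    by (intro integrable_mult_right Bochner_Integration.integrable_add Bochner_Integration.integrable_diff iW)
  have iF: "integrable (surface_measure \<Omega>) (\<lambda>x. F x \<bullet> nrm x)"
  proof (rule Bochner_Integration.integrable_bound)
    show "integrable (surface_measure \<Omega>) (\<lambda>x. norm (F x))"
      by (intro int\<Gamma> continuous_intros cf Ck_upto_1_continuous CF')
    show "AE x in surface_measure \<Omega>. norm (F x \<bullet> nrm x) \<le> norm (norm (F x))"
      using unit
    proof eventually_elim
      case (elim x)
      then show ?case using Cauchy_Schwarz_ineq2[of "F x" "nrm x"] by simp
    qed
  qed measurable
  have "(LINT x|surface_measure \<Omega>. w x + lam/\<gamma>*dt*(Pd x * Pd x) + \<nu>*dt*(H x \<bullet> (ut x - uw x)) + \<nu>*dt*(H x \<bullet> uw x))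
      \<le> (LINT x|surface_measure \<Omega>. - (F x \<bullet> nrm x))"
    using boundary unfolding Pd_def[symmetric]
    by (intro integral_mono_AE Bochner_Integration.integrable_add integrable_mult_right
        Bochner_Integration.integrable_minus iw iPd iH iF continuous_intros cut uw)
  \<comment> \<open>The simplifier would expand the difference under the inner product, so this
    integrability fact is supplied for splitting the integral.\<close>
  moreover have "integrable (surface_measure \<Omega>) (\<lambda>x. H x \<bullet> (ut x - uw x))"
    by (intro iH continuous_intros cut uw)
  ultimately have bdry_le: "(LINT x|surface_measure \<Omega>. w x) + lam/\<gamma>*dt*(LINT x|surface_measure \<Omega>. Pd x * Pd x)
      + \<nu>*dt*(LINT x|surface_measure \<Omega>. H x \<bullet> (ut x - uw x)) + \<nu>*dt*(LINT x|surface_measure \<Omega>. H x \<bullet> uw x)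
      \<le> - (LINT x|surface_measure \<Omega>. F x \<bullet> nrm x)"
    by (simp add: iw iPd iH[OF uw])

  \<comment> \<open>Assembling the energy law\<close>
  have n_slip: "(L2_norm (surface_measure \<Omega>) (\<lambda>x. sqrt (l (?\<phi>s x)) *\<^sub>R (ut x - uw x)))\<^sup>2
      = (LINT x|surface_measure \<Omega>. H x \<bullet> (ut x - uw x))"
    unfolding L2_norm_power2 H_def using l(1) by (simp add: mult.assoc[symmetric])
  have n_wall: "L2_inner (surface_measure \<Omega>) (\<lambda>x. l (?\<phi>s x) *\<^sub>R (ut x - uw x)) uw
      = (LINT x|surface_measure \<Omega>. H x \<bullet> uw x)"
    unfolding L2_inner_def H_def ..
  have n_dot: "(L2_norm (surface_measure \<Omega>) (phi_dot nrm dt \<phi> ut (n+1)))\<^sup>2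
      = (LINT x|surface_measure \<Omega>. Pd x * Pd x)"
    unfolding L2_norm_power2 Pd_def by simp
  have energy_eq: "energy \<Omega> lam \<epsilon> C v f h k = (LINT x|lebesgue_on \<Omega>. dens v f h x)
      + lam * (LINT x|surface_measure \<Omega>. (k x)\<^sup>2) - lam * C * measure (surface_measure \<Omega>) (frontier \<Omega>)" for v f h k
    by (simp add: energy_def dens_def)
  have e_int: "(LINT x|lebesgue_on \<Omega>. e x) = 1/2 * (LINT x|lebesgue_on \<Omega>. dens (u (n+1)) (\<phi> (n+1)) (U (n+1)) x)
      + 1/2 * (LINT x|lebesgue_on \<Omega>. dens (star u (n+1+1)) (star \<phi> (n+1+1)) (star U (n+1+1)) x)
      + dt\<^sup>2/3 * (LINT x|lebesgue_on \<Omega>. grad (p (n+1)) x \<bullet> grad (p (n+1)) x)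
      - 1/2 * (LINT x|lebesgue_on \<Omega>. dens (u n) (\<phi> n) (U n) x)
      - 1/2 * (LINT x|lebesgue_on \<Omega>. dens (star u (n+1)) (star \<phi> (n+1)) (star U (n+1)) x)
      - dt\<^sup>2/3 * (LINT x|lebesgue_on \<Omega>. grad (p n) x \<bullet> grad (p n) x)"
    unfolding e_def using idens igrad[OF Cp(1)] igrad[OF Cp(2)] by simp
  have w_int: "(LINT x|surface_measure \<Omega>. w x) = lam/2 * ((LINT x|surface_measure \<Omega>. (W (n+1) x)\<^sup>2)
      + (LINT x|surface_measure \<Omega>. (star W (n+1+1) x)\<^sup>2) - (LINT x|surface_measure \<Omega>. (W n x)\<^sup>2)
      - (LINT x|surface_measure \<Omega>. (star W (n+1) x)\<^sup>2))"
    unfolding w_def using iW by simp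
  have "energy_bdf \<Omega> lam \<epsilon> C dt u \<phi> U W p (n+1) - energy_bdf \<Omega> lam \<epsilon> C dt u \<phi> U W p n
      = (LINT x|lebesgue_on \<Omega>. e x) + (LINT x|surface_measure \<Omega>. w x)"
    unfolding energy_bdf_def energy_eq L2_norm_power2 e_int w_int by (simp add: algebra_simps)
  \<comment> \<open>The divergence theorem has made the right-hand sides of \<open>int_le\<close>
    and \<open>bdry_le\<close> opposite surface integrals, which cancel on addition.\<close>
  then show ?thesis
    using int_le bdry_le unfolding n_slip n_wall n_dot by linarith
qed

end
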